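(* Let $d\ge 2$ be an integer, $0<\sigma<1$, and let $v\in\mathbb{R}$ be given by $$v^2=\frac{\sigma}{8\pi^2}\int_0^1\frac{dt}{(2\sin(\pi t))^\sigma}.$$ Then the absolute minimum on $\Lambda$ of the functional $\mathcal{A}^\sigma:\Lambda\to[0,+\infty]$, $$\mathcal{A}^\sigma(y)=\int_0^1\frac{v^2}{2}\|\dot y(s)\|^2\,ds+\frac12\int_0^1\int_0^1\frac{dr\,ds}{\|y(s)-y(r)\|^\sigma},$$ is attained, and it is attained at and only at the unit circles $$y(t)=a e^{2\pi i t}+\bar a e^{-2\pi i t}=E_1\cos(2\pi t)+E_2\sin(2\pi t),$$ where $a\in\mathbb{C}^d$ and $E_1=2\operatorname{Re}(a)$, $E_2=-2\operatorname{Im}(a)$ are orthogonal unit vectors in $\mathbb{R}^d$.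
   Context: $\|\cdot\|$ is the Euclidean norm on $\mathbb{R}^d$. $H^1_1(\mathbb{R},\mathbb{R}^d)$ denotes the set of $1$-periodic functions $\mathbb{R}\to\mathbb{R}^d$ whose restriction to $[0,1]$ is in the Sobolev space $H^1([0,1],\mathbb{R}^d)$ (identified with their continuous representatives), and $$\Lambda:=\left\{y\in H^1_1(\mathbb{R},\mathbb{R}^d)\ \Big|\ \int_0^1 y(s)\,ds=0\right\}.$$ For $a\in\mathbb{C}^d$ we write $a=\operatorname{Re}a+i\operatorname{Im}a$ and $\bar a=\operatorname{Re}a-i\operatorname{Im}a$ with $\operatorname{Re}a,\operatorname{Im}a\in\mathbb{R}^d$. *)

theory Defs
  imports "HOL-Analysis.Analysis"
begin

definition L2_01 :: "(real \<Rightarrow> 'a::euclidean_space) set" where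
  "L2_01 = {f. f \<in> borel_measurable (lebesgue_on {0..1}) \<and>
               integrable (lebesgue_on {0..1}) (\<lambda>t. (norm (f t))\<^sup>2)}"

text \<open>Weak derivatives are tested against compactly supported \<open>C\<^sup>1\<close> functions on the open
  interval, as is usual in dimension one; smooth test functions give the same notion. The closed
  support is bounded, hence compact, as soon as it lies in the interval.\<close>

definition test_functions :: "(real \<Rightarrow> real) set" where
  "test_functions = {\<phi>. \<phi> C1_differentiable_on UNIV \<and> closure {t. \<phi> t \<noteq> 0} \<subseteq> {0<..<1}}"

definition has_weak_deriv ::
  "(real \<Rightarrow> 'a::euclidean_space) \<Rightarrow> (real \<Rightarrow> 'a) \<Rightarrow> bool" where
  "has_weak_deriv y g \<longleftrightarrow>
     (\<forall>\<phi>\<in>test_functions.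
        (LINT t|lebesgue_on {0..1}. deriv \<phi> t *\<^sub>R y t) =
        - (LINT t|lebesgue_on {0..1}. \<phi> t *\<^sub>R g t))"

text \<open>The elements of \<open>H\<^sup>1([0,1])\<close> are represented by their continuous representatives.\<close>

definition H1_01 :: "(real \<Rightarrow> 'a::euclidean_space) set" where
  "H1_01 = {y. continuous_on {0..1} y \<and> y \<in> L2_01 \<and> (\<exists>g\<in>L2_01. has_weak_deriv y g)}"

text \<open>The weak derivative is determined only almost everywhere on \<open>[0,1]\<close>; the integral of its
  squared norm does not depend on the representative chosen here.\<close>

definition weak_deriv :: "(real \<Rightarrow> 'a::euclidean_space) \<Rightarrow> real \<Rightarrow> 'a" where
  "weak_deriv y = (SOME g. g \<in> L2_01 \<and> has_weak_deriv y g)"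

definition H1_periodic :: "(real \<Rightarrow> 'a::euclidean_space) set" where
  "H1_periodic = {y. (\<forall>t. y (t + 1) = y t) \<and> y \<in> H1_01}"

definition Lambda :: "(real \<Rightarrow> 'a::euclidean_space) set" where
  "Lambda = {y \<in> H1_periodic. (LINT s|lebesgue_on {0..1}. y s) = 0}"

text \<open>In \<^typ>\<open>ennreal\<close> one has \<open>1 / 0 = \<infinity>\<close>, so collisions contribute the value \<open>\<infinity>\<close> to
  the integrand, and the functional takes values in \<open>[0,\<infinity>]\<close>.\<close>

definition action :: "real \<Rightarrow> real \<Rightarrow> (real \<Rightarrow> 'a::euclidean_space) \<Rightarrow> ennreal" where
  "action v \<sigma> y =
     (\<integral>\<^sup>+ s. ennreal (v\<^sup>2 / 2 * (norm (weak_deriv y s))\<^sup>2) \<partial>lebesgue_on {0..1}) +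
     1 / 2 * (\<integral>\<^sup>+ s. (\<integral>\<^sup>+ r. 1 / ennreal (norm (y s - y r) powr \<sigma>)
                 \<partial>lebesgue_on {0..1}) \<partial>lebesgue_on {0..1})"

definition Re_vec :: "complex ^ 'd \<Rightarrow> real ^ 'd" where
  "Re_vec a = (\<chi> k. Re (a $ k))"

definition Im_vec :: "complex ^ 'd \<Rightarrow> real ^ 'd" where
  "Im_vec a = (\<chi> k. Im (a $ k))"

definition cnj_vec :: "complex ^ 'd \<Rightarrow> complex ^ 'd" where
  "cnj_vec a = (\<chi> k. cnj (a $ k))"

definition of_real_vec :: "real ^ 'd \<Rightarrow> complex ^ 'd" where
  "of_real_vec x = (\<chi> k. complex_of_real (x $ k))"

definition unit_circle :: "(real \<Rightarrow> real ^ 'd) \<Rightarrow> bool" where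
  "unit_circle y \<longleftrightarrow>
     (\<exists>(a :: complex ^ 'd) E1 E2.
        E1 = 2 *\<^sub>R Re_vec a \<and> E2 = - 2 *\<^sub>R Im_vec a \<and>
        norm E1 = 1 \<and> norm E2 = 1 \<and> orthogonal E1 E2 \<and>
        (\<forall>t. of_real_vec (y t) = exp (2 * pi * \<i> * t) *s a + exp (- (2 * pi * \<i> * t)) *s cnj_vec a) \<and>
        (\<forall>t. y t = cos (2 * pi * t) *\<^sub>R E1 + sin (2 * pi * t) *\<^sub>R E2))"

end

(* A point pair of the curve at parameter distance t contributes the convex function
   x |-> x^(-\<sigma>/2) of its squared distance x. Replacing this function by its tangent at the squared
   chord length 4 sin^2(pi t) of the unit circle reduces the claim to the chord inequality
     int_0^1 |y(s+t) - y(s)|^2 ds <= (sin^2(pi t) / pi^2) int_0^1 |y'(s)|^2 ds;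
   the value of v is the one for which the two quadratic terms cancel. Equality forces
   |y(s+t) - y(s)| = 2 sin(pi t) for all s and t, and such a curve is congruent to the unit circle.

   The chord inequality is proved without Fourier series. Let X(t) be its left-hand side and let M
   bound the mean square of y. By Cauchy-Schwarz, r = 1 - X / (2 M) satisfies
   r(2t) >= 2 r(t)^2 - 1, the duplication formula of the cosine, and X(t) <= t^2 int |y'|^2.
   Iterating from small t gives r(t) >= cos(w t) with w^2 = int |y'|^2 / M. For M the mean square
   itself this yields the Wirtinger inequality, since X has mean 2 M; that inequality in turn allows
   M = int |y'|^2 / (4 pi^2), i.e. w = 2 pi, which is the chord inequality. *)

theory Submission
  imports Defs
begin


section \<open>The chord inequality\<close>

text \<open>Let E be the integral of |y'|^2 and k(t) = (2 sin(pi t))^(-\<sigma>). At c^2 = 4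
  sin^2(pi t) the tangent is k(t) (1 + \<sigma>/2 - (\<sigma>/2) x / c^2). The chord inequality
  bounds the mean of its quadratic part by k(t) \<sigma> E / (8 pi^2), whose integral is v^2 E;
  hence twice the action is at least (1 + \<sigma>/2) times the integral of k. Collisions make the
  potential infinite, so the quadratic part is added to the potential instead of being subtracted
  from the bound. The equality case rests on the strictness of the tangent inequality: it fixes the
  chords for almost all s and t, and continuity extends this to all. The cosine comparison stops at
  w t = pi, since the doubling step squares a cosine that must be nonnegative at t/2. For w = 2 pi
  this means t = 1/2, and the symmetry t -> 1 - t covers the other half. Weak derivatives enter
  through y(b) - y(a) = int_a^b y', obtained by testing against smoothed indicators of
  (a,b].\<close>

lemma continuous_comp_shift:
  assumes "continuous_on UNIV (f :: real \<Rightarrow> 'a::topological_space)"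
  shows "continuous_on A (\<lambda>s. f (s + c))"
  by (rule continuous_on_compose2[OF assms]) (auto intro!: continuous_intros)

lemma integral_periodic_shift:
  fixes f :: "real \<Rightarrow> 'a::euclidean_space"
  assumes cont: "continuous_on UNIV f" and per: "\<And>x. f (x + 1) = f x" and c: "0 \<le> c" "c \<le> 1"
  shows "integral {0..1} (\<lambda>s. f (s + c)) = integral {0..1} f"
proof -
  have int: "f integrable_on {a..b}" for a b
    by (intro integrable_continuous_interval continuous_on_subset[OF cont]) auto
  have "integral {0..1} (\<lambda>s. f (s + c)) = integral {c..1 + c} f"
    using integral_shift[of 0 c 1 f] continuous_on_subset[OF cont, of "{0 + c..1 + c}"] by (simp add: o_def)
  also have "\<dots> = integral {c..1} f + integral {1..1 + c} f"
    using Henstock_Kurzweil_Integration.integral_combine[of c 1 "1 + c" f] c int by simp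
  also have "integral {1..1 + c} f = integral {0..c} (\<lambda>s. f (s + 1))"
    using integral_shift[of 0 1 c f] continuous_on_subset[OF cont, of "{0 + 1..c + 1}"]
    by (simp add: o_def add.commute)
  also have "\<dots> = integral {0..c} f"
    by (simp add: per)
  also have "integral {c..1} f + integral {0..c} f = integral {0..1} f"
    using Henstock_Kurzweil_Integration.integral_combine[of 0 c 1 f] c int by (simp add: add.commute)
  finally show ?thesis .
qed

text \<open>For periodic \<open>y\<close> this is an autocorrelation in disguise: expanding the
  square gives twice the mean square minus twice the mean of
  \<open>y (s + t) \<bullet> y s\<close>.\<close>

definition chord :: "(real \<Rightarrow> 'a::euclidean_space) \<Rightarrow> real \<Rightarrow> real" where
  "chord y t = integral {0..1} (\<lambda>s. (norm (y (s + t) - y s))\<^sup>2)"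

text \<open>The second difference of step t, centred at s + t, has mean square 4 X(t) - X(2t), and
  its inner product with y(s + t) has mean -X(t), where X is the chord function. The claim is
  Cauchy-Schwarz for these two functions.\<close>

lemma chord_doubling:
  fixes y :: "real \<Rightarrow> 'a::euclidean_space"
  assumes cont: "continuous_on UNIV y" and per: "\<And>x. y (x + 1) = y x" and t: "0 \<le> t" "t \<le> 1"
    and M: "integral {0..1} (\<lambda>s. (norm (y s))\<^sup>2) \<le> M" "0 < M"
  shows "(chord y t)\<^sup>2 \<le> M * (4 * chord y t - chord y (2 * t))"
proof -
  note [continuous_intros] = continuous_comp_shift[OF cont] continuous_on_subset[OF cont]
  have int: "f integrable_on {0..1::real}" if "continuous_on UNIV f" for f :: "real \<Rightarrow> real"
    by (intro integrable_continuous_interval continuous_on_subset[OF that]) auto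
  define z where "z s = y (s + 2 * t) - 2 *\<^sub>R y (s + t) + y s" for s
  have per': "y (x + 1 + a) = y (x + a)" for x a
    using per[of "x + a"] by (simp add: algebra_simps)
  have zc [continuous_intros]: "continuous_on UNIV z"
    unfolding z_def by (intro continuous_intros) auto
  have tt: "s + t + t = s + 2 * t" for s
    by simp
  have sh: "integral {0..1} (\<lambda>s. (norm (y (s + 2 * t) - y (s + t)))\<^sup>2) = chord y t"
    using integral_periodic_shift[of "\<lambda>s. (norm (y (s + t) - y s))\<^sup>2" t] t
    unfolding chord_def by (simp add: per per' tt continuous_intros)
  have Z: "integral {0..1} (\<lambda>s. (norm (z s))\<^sup>2) = 4 * chord y t - chord y (2 * t)"
  proof -
    \<comment> \<open>Parallelogram law: \<open>z s\<close> is the difference of two consecutive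
      increments, and their sum is the increment over 2t.\<close>
    have "(norm (z s))\<^sup>2 = 2 * (norm (y (s + 2 * t) - y (s + t)))\<^sup>2 + 2 * (norm (y (s + t) - y s))\<^sup>2
        - (norm (y (s + 2 * t) - y s))\<^sup>2" for s
      unfolding z_def power2_norm_eq_inner by (simp add: inner_commute algebra_simps)
    then have "integral {0..1} (\<lambda>s. (norm (z s))\<^sup>2) =
      2 * integral {0..1} (\<lambda>s. (norm (y (s + 2 * t) - y (s + t)))\<^sup>2) + 2 * chord y t - chord y (2 * t)"
      unfolding chord_def
      by (simp add: Henstock_Kurzweil_Integration.integral_diff Henstock_Kurzweil_Integration.integral_add int continuous_intros)
    then show ?thesis using sh by simp
  qed
  have X: "integral {0..1} (\<lambda>s. z s \<bullet> y (s + t)) = - chord y t"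
  proof -
    \<comment> \<open>The first two terms are the same function of s up to a shift by t, so their
      integrals cancel and only the squared chord remains.\<close>
    have eq: "z s \<bullet> y (s + t) = (y (s + 2 * t) - y (s + t)) \<bullet> y (s + t)
         - (y (s + t) - y s) \<bullet> y s - (norm (y (s + t) - y s))\<^sup>2" for s
      unfolding z_def power2_norm_eq_inner by (simp add: inner_commute algebra_simps)
    have "integral {0..1} (\<lambda>s. (y (s + 2 * t) - y (s + t)) \<bullet> y (s + t))
        = integral {0..1} (\<lambda>s. (y (s + t) - y s) \<bullet> y s)"
      using integral_periodic_shift[of "\<lambda>s. (y (s + t) - y s) \<bullet> y s" t] t
      by (simp add: per per' tt continuous_intros)
    then show ?thesis
      unfolding eq chord_def
      by (simp add: Henstock_Kurzweil_Integration.integral_diff Henstock_Kurzweil_Integration.integral_add int continuous_intros)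
  qed
  have Y: "integral {0..1} (\<lambda>s. (norm (y (s + t)))\<^sup>2) = integral {0..1} (\<lambda>s. (norm (y s))\<^sup>2)"
    using integral_periodic_shift[of "\<lambda>s. (norm (y s))\<^sup>2" t] t per
    by (simp add: continuous_intros)
  \<comment> \<open>The minimiser of Z - 2 l X + l^2 M over l. Optimising with M in place of the
    actual mean square proves Cauchy-Schwarz and absorbs the slack in M at once.\<close>
  define l where "l = chord y t / M"
  have "0 \<le> integral {0..1} (\<lambda>s. (norm (z s + l *\<^sub>R y (s + t)))\<^sup>2)"
    by (intro Henstock_Kurzweil_Integration.integral_nonneg int continuous_intros) auto
  also have "\<dots> = integral {0..1} (\<lambda>s. (norm (z s))\<^sup>2 + 2 * l * (z s \<bullet> y (s + t)) + l\<^sup>2 * (norm (y (s + t)))\<^sup>2)"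
    unfolding power2_norm_eq_inner
    by (intro Henstock_Kurzweil_Integration.integral_cong) (simp add: inner_commute algebra_simps power2_eq_square)
  also have "\<dots> = 4 * chord y t - chord y (2 * t) - 2 * l * chord y t + l\<^sup>2 * integral {0..1} (\<lambda>s. (norm (y s))\<^sup>2)"
    by (simp add: Henstock_Kurzweil_Integration.integral_add int continuous_intros Z X Y)
  also have "\<dots> \<le> 4 * chord y t - chord y (2 * t) - 2 * l * chord y t + l\<^sup>2 * M"
    using M by (intro add_left_mono mult_left_mono) auto
  also have "\<dots> = 4 * chord y t - chord y (2 * t) - (chord y t)\<^sup>2 / M"
    using M by (simp add: l_def field_simps power2_eq_square)
  finally show ?thesis
    using M by (simp add: field_simps)
qed

text \<open>Starting values for the iteration of the doubling inequality. Since cos x >= 1 - x^2/2,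
  the frequency has to be raised strictly; then 1 - cos(w' x) = 2 sin^2(w' x / 2) and sin u / u > w
  / w' near 0 give the room.\<close>

lemma cos_below_parabola:
  fixes w w' :: real
  assumes "0 \<le> w" "w < w'"
  shows "\<exists>d>0. \<forall>x. 0 < x \<longrightarrow> x < d \<longrightarrow> cos (w' * x) \<le> 1 - w\<^sup>2 * x\<^sup>2 / 2"
proof -
  have "((\<lambda>x. sin x / x) \<longlongrightarrow> 1) (at (0::real))"
    using DERIV_sin[of 0] by (simp add: has_field_derivative_iff)
  moreover have "w / w' < 1" using assms by simp
  ultimately have "eventually (\<lambda>x. w / w' < sin x / x) (at (0::real))"
    by (rule order_tendstoD(1))
  then obtain d where d: "d > 0" "\<And>x. x \<noteq> 0 \<Longrightarrow> dist x 0 < d \<Longrightarrow> w / w' < sin x / x"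
    unfolding eventually_at by blast
  have "cos (w' * x) \<le> 1 - w\<^sup>2 * x\<^sup>2 / 2" if "0 < x" "x < 2 * d / w'" for x
  proof -
    have "w' > 0" using assms by simp
    define u where "u = w' * x / 2"
    have u: "0 < u" "u < d" using that \<open>w' > 0\<close> by (auto simp: u_def field_simps)
    then have "w / w' < sin u / u" using d(2)[of u] by simp
    then have "w / w' * u < sin u" using u by (simp add: pos_less_divide_eq)
    moreover have "w / w' * u = w * x / 2" using \<open>w' > 0\<close> by (simp add: u_def)
    ultimately have "w * x / 2 \<le> sin u" by linarith
    then have "(w * x / 2)\<^sup>2 \<le> (sin u)\<^sup>2"
      using assms that by (intro power_mono) auto
    moreover have "cos (w' * x) = 1 - 2 * (sin u)\<^sup>2"
      using cos_double_sin[of u] by (simp add: u_def)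
    ultimately show ?thesis by (simp add: power_mult_distrib power_divide)
  qed
  then show ?thesis
    using d(1) assms by (intro exI[of _ "2 * d / w'"]) auto
qed

text \<open>The cosine is the extremal solution of the doubling inequality with second order behaviour
  \<open>1 - w\<^sup>2 t\<^sup>2 / 2\<close> at \<open>0\<close>.\<close>

lemma doubling_cos_le:
  fixes r :: "real \<Rightarrow> real"
  assumes dbl: "\<And>t. 0 \<le> t \<Longrightarrow> 2 * t \<le> 1 \<Longrightarrow> 2 * (r t)\<^sup>2 - 1 \<le> r (2 * t)"
    and par: "\<And>t. 0 \<le> t \<Longrightarrow> t \<le> 1 \<Longrightarrow> 1 - w\<^sup>2 * t\<^sup>2 / 2 \<le> r t"
    and w: "0 \<le> w" and t: "0 \<le> t" "t \<le> 1" "w * t \<le> pi"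
  shows "cos (w * t) \<le> r t"
proof -
  consider "t = 0" | "t > 0" "w * t = pi" | "t > 0" "w * t < pi" using t by fastforce
  then show ?thesis
  proof cases
    case 1 then show ?thesis using par[of 0] by simp
  next
    \<comment> \<open>No larger frequency fits below pi here, but cos pi = -1 is the trivial lower
      bound that a single doubling yields.\<close>
    case 2 
    have "2 * (r (t / 2))\<^sup>2 - 1 \<le> r t" using dbl[of "t / 2"] t by simp
    then have "- 1 \<le> r t" using zero_le_power2[of "r (t / 2)"] by linarith
    then show ?thesis using 2 by simp
  next
    \<comment> \<open>The claim is proved for every slightly larger \<open>w'\<close>, for which the
      parabola dominates the cosine near 0, and \<open>w'\<close> then tends to
      \<open>w\<close>.\<close>
    case 3
    have *: "cos (w' * t) \<le> r t" if w': "w < w'" "w' * t \<le> pi" for w'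
    proof -
      obtain d where d: "d > 0" "\<And>x. 0 < x \<Longrightarrow> x < d \<Longrightarrow> cos (w' * x) \<le> 1 - w\<^sup>2 * x\<^sup>2 / 2"
        using cos_below_parabola[OF w w'(1)] by blast
      \<comment> \<open>After \<open>n\<close> halvings \<open>t\<close> has reached the range where
        the parabola dominates; the induction undoes the halvings, \<open>k\<close> of them so
        far.\<close>
      obtain n where n: "t / d < 2 ^ n"
        using real_arch_pow[of 2 "t / d"] by auto
      have small: "0 < t / 2 ^ n" "t / 2 ^ n < d" using n d(1) 3 by (auto simp: field_simps)
      have le1: "t / 2 ^ m \<le> t" for m
        using 3 by (simp add: divide_le_eq)
      have "k \<le> n \<Longrightarrow> cos (w' * (t / 2 ^ (n - k))) \<le> r (t / 2 ^ (n - k))" for k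
      proof (induction k)
        case 0
        have "1 - w\<^sup>2 * (t / 2 ^ n)\<^sup>2 / 2 \<le> r (t / 2 ^ n)"
          using small(1) le1[of n] t(2) by (intro par) linarith+
        with d(2)[OF small] show ?case by simp
      next
        case (Suc k)
        define u where "u = t / 2 ^ (n - k)"
        have nk: "n - k = Suc (n - Suc k)" using Suc.prems by simp
        have u2: "2 * u = t / 2 ^ (n - Suc k)" unfolding u_def nk by simp
        have u0: "0 \<le> u" "2 * u \<le> t" using 3 le1[of "n - Suc k"] u2 by (auto simp: u_def)
        have "w' * (2 * u) \<le> w' * t" using w w' u0 by (intro mult_left_mono) auto
        then have "w' * (2 * u) \<le> pi" using w'(2) by linarith
        \<comment> \<open>The cosine is nonnegative on this range, so squaring preserves the
          induction hypothesis; hence the restriction to \<open>w * t \<le> pi\<close>.\<close>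
        then have "w' * u \<le> pi / 2" "0 \<le> w' * u" using w w' u0 by auto
        then have "0 \<le> cos (w' * u)" by (intro cos_ge_zero) auto
        moreover have "cos (w' * u) \<le> r u" using Suc unfolding u_def by simp
        ultimately have "(cos (w' * u))\<^sup>2 \<le> (r u)\<^sup>2" by (intro power_mono)
        then have "cos (w' * (2 * u)) \<le> 2 * (r u)\<^sup>2 - 1"
          using cos_double_cos[of "w' * u"] by (simp add: mult.left_commute)
        also have "\<dots> \<le> r (2 * u)" using dbl[of u] u0 t by auto
        finally show ?case unfolding u2 .
      qed
      from this[of n] show ?thesis by simp
    qed
    have "((\<lambda>w'. cos (w' * t)) \<longlongrightarrow> cos (w * t)) (at_right w)"
      by (intro tendsto_intros)
    moreover have "eventually (\<lambda>w'. cos (w' * t) \<le> r t) (at_right w)"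
    proof (rule eventually_mono)
      show "eventually (\<lambda>w'. w' \<in> {w<..<pi / t}) (at_right w)"
        using 3 by (intro eventually_at_right_real) (simp add: field_simps)
    qed (use 3 in \<open>auto intro!: * simp: field_simps\<close>)
    ultimately show ?thesis
      by (rule tendsto_upperbound) simp
  qed
qed

lemma chord_le_cos:
  fixes y :: "real \<Rightarrow> 'a::euclidean_space"
  assumes cont: "continuous_on UNIV y" and per: "\<And>x. y (x + 1) = y x"
    and sq: "\<And>t. 0 \<le> t \<Longrightarrow> t \<le> 1 \<Longrightarrow> chord y t \<le> t\<^sup>2 * (w\<^sup>2 * M)"
    and M: "integral {0..1} (\<lambda>s. (norm (y s))\<^sup>2) \<le> M" "0 < M"
    and w: "0 \<le> w" and t: "0 \<le> t" "t \<le> 1" "w * t \<le> pi"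
  shows "chord y t \<le> 2 * M * (1 - cos (w * t))"
proof -
  define r where "r t = 1 - chord y t / (2 * M)" for t
  have "cos (w * t) \<le> r t"
  proof (rule doubling_cos_le[OF _ _ w t])
    fix t :: real assume t: "0 \<le> t" "2 * t \<le> 1"
    have "chord y (2 * t) \<le> 4 * chord y t - (chord y t)\<^sup>2 / M"
      using chord_doubling[OF cont per _ _ M, of t] t M(2) by (simp add: field_simps)
    then have "1 - (4 * chord y t - (chord y t)\<^sup>2 / M) / (2 * M) \<le> r (2 * t)"
      unfolding r_def using M(2) by (intro diff_left_mono divide_right_mono) auto
    moreover have "1 - (4 * chord y t - (chord y t)\<^sup>2 / M) / (2 * M) = 2 * (r t)\<^sup>2 - 1"
      using M(2) by (simp add: r_def field_simps power2_eq_square)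
    ultimately show "2 * (r t)\<^sup>2 - 1 \<le> r (2 * t)" by simp
  next
    fix t :: real assume "0 \<le> t" "t \<le> 1"
    then show "1 - w\<^sup>2 * t\<^sup>2 / 2 \<le> r t"
      using sq[of t] M(2) by (simp add: r_def field_simps)
  qed
  then show ?thesis using M(2) by (simp add: r_def field_simps)
qed

text \<open>Shifting s by t turns the chord from s to s + (1 - t) into the one from s + t to s + 1,
  which is the chord of step t traversed backwards. This carries estimates for t <= 1/2 over to the
  whole period.\<close>

lemma chord_reflect:
  fixes y :: "real \<Rightarrow> 'a::euclidean_space"
  assumes cont: "continuous_on UNIV y" and per: "\<And>x. y (x + 1) = y x" and t: "0 \<le> t" "t \<le> 1"
  shows "chord y (1 - t) = chord y t"
proof -
  note [continuous_intros] = continuous_comp_shift[OF cont] continuous_on_subset[OF cont]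
  have "y (s + t + (1 - t)) = y s" for s using per[of s] by (simp add: algebra_simps)
  moreover have "y (s + 1 + (1 - t)) = y (s + (1 - t))" for s using per[of "s + (1 - t)"] by (simp add: algebra_simps)
  ultimately show ?thesis
    using integral_periodic_shift[of "\<lambda>s. (norm (y (s + (1 - t)) - y s))\<^sup>2" t] t per
    unfolding chord_def by (simp add: norm_minus_commute continuous_intros)
qed

text \<open>Expanding the square and integrating over t first, the mixed term becomes the inner
  product of y(s) with the mean of y, which vanishes. This is how the zero mean enters the chord
  inequality.\<close>

lemma integral_chord:
  fixes y :: "real \<Rightarrow> 'a::euclidean_space"
  assumes cont: "continuous_on UNIV y" and per: "\<And>x. y (x + 1) = y x"
    and mean: "integral {0..1} y = 0"
  shows "continuous_on {0..1} (chord y)"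
    and "integral {0..1} (chord y) = 2 * integral {0..1} (\<lambda>s. (norm (y s))\<^sup>2)"
proof -
  note [continuous_intros] = continuous_comp_shift[OF cont] continuous_on_subset[OF cont]
  have int: "f integrable_on {0..1::real}" if "continuous_on UNIV f" for f :: "real \<Rightarrow> 'b::euclidean_space"
    by (intro integrable_continuous_interval continuous_on_subset[OF that]) auto
  have c2: "continuous_on A (\<lambda>(t, s). (norm (y (s + t) - y s))\<^sup>2)" for A
    unfolding split_beta
    by (intro continuous_intros continuous_on_compose2[OF cont]) auto
  show "continuous_on {0..1} (chord y)"
    unfolding chord_def
    using integral_continuous_on_param[of "{0..1::real}" 0 "1::real" "\<lambda>t s. (norm (y (s + t) - y s))\<^sup>2"] c2
    by simp
  have "integral {0..1} (chord y) = integral {0..1} (\<lambda>s. integral {0..1} (\<lambda>t. (norm (y (s + t) - y s))\<^sup>2))"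
    unfolding chord_def
    using integral_swap_continuous[of "0::real" "0::real" 1 1 "\<lambda>t s. (norm (y (s + t) - y s))\<^sup>2"] c2
    by simp
  also have "\<dots> = integral {0..1} (\<lambda>s. (norm (y s))\<^sup>2 + integral {0..1} (\<lambda>s. (norm (y s))\<^sup>2))"
  proof (rule Henstock_Kurzweil_Integration.integral_cong)
    fix s :: real assume s: "s \<in> {0..1}"
    have eq: "(norm (y (s + t) - y s))\<^sup>2 = (norm (y s))\<^sup>2 + (norm (y (t + s)))\<^sup>2 - 2 * (y (t + s) \<bullet> y s)" for t
      unfolding power2_norm_eq_inner by (simp add: inner_commute algebra_simps)
    have "integral {0..1} (\<lambda>t. y (t + s) \<bullet> y s) = integral {0..1} (\<lambda>t. y (t + s)) \<bullet> y s"
      by (rule integral_linear[OF int bounded_linear_inner_left, unfolded o_def]) (intro continuous_intros)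
    also have "\<dots> = 0"
      using integral_periodic_shift[OF cont per, of s] s mean by simp
    finally have "integral {0..1} (\<lambda>t. y (t + s) \<bullet> y s) = 0" .
    moreover have "integral {0..1} (\<lambda>t. (norm (y (t + s)))\<^sup>2) = integral {0..1} (\<lambda>t. (norm (y t))\<^sup>2)"
      using integral_periodic_shift[of "\<lambda>s. (norm (y s))\<^sup>2" s] s per
      by (simp add: continuous_intros)
    ultimately show "integral {0..1} (\<lambda>t. (norm (y (s + t) - y s))\<^sup>2)
        = (norm (y s))\<^sup>2 + integral {0..1} (\<lambda>s. (norm (y s))\<^sup>2)"
      unfolding eq by (simp add: Henstock_Kurzweil_Integration.integral_add Henstock_Kurzweil_Integration.integral_diff int continuous_intros)
  qed
  also have "\<dots> = 2 * integral {0..1} (\<lambda>s. (norm (y s))\<^sup>2)"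
    by (simp add: Henstock_Kurzweil_Integration.integral_add int continuous_intros)
  finally show "integral {0..1} (chord y) = 2 * integral {0..1} (\<lambda>s. (norm (y s))\<^sup>2)" .
qed

text \<open>If the mean square Y were too large, the comparison would hold with some w < 2 pi,
  placing the chord function strictly below 2 Y (1 - cos(2 pi t)) for 0 < t <= 1/2. Both functions
  have integral 2 Y over a period, a contradiction.\<close>

lemma wirtinger:
  fixes y :: "real \<Rightarrow> 'a::euclidean_space"
  assumes cont: "continuous_on UNIV y" and per: "\<And>x. y (x + 1) = y x"
    and mean: "integral {0..1} y = 0"
    and sq: "\<And>t. 0 \<le> t \<Longrightarrow> t \<le> 1 \<Longrightarrow> chord y t \<le> t\<^sup>2 * P" and P: "0 \<le> P"
  shows "integral {0..1} (\<lambda>s. (norm (y s))\<^sup>2) \<le> P / (4 * pi\<^sup>2)"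
proof (rule ccontr)
  define Y where "Y = integral {0..1} (\<lambda>s. (norm (y s))\<^sup>2)"
  assume "\<not> ?thesis"
  then have less: "P / (4 * pi\<^sup>2) < Y" by (simp add: Y_def)
  then have Y0: "0 < Y" using P by (smt (verit) divide_nonneg_nonneg zero_le_power2)
  define w where "w = sqrt (P / Y)"
  have w0: "0 \<le> w" and wP: "w\<^sup>2 * Y = P" using P Y0 by (auto simp: w_def)
  have "w\<^sup>2 < (2 * pi)\<^sup>2" using less Y0 P by (simp add: w_def field_simps)
  then have w2: "w < 2 * pi" by (rule power_less_imp_less_base) simp
  have bd: "chord y t \<le> 2 * Y * (1 - cos (w * t))" if "0 \<le> t" "t \<le> 1/2" for t
  proof (rule chord_le_cos[OF cont per _ _ Y0 w0])
    show "w * t \<le> pi" using mult_mono[of w "2 * pi" t "1/2"] that w0 w2 by simp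
  qed (use that sq wP Y_def in auto)
  have cmono: "cos (2 * pi * t) \<le> cos (w * t)" if "0 \<le> t" "t \<le> 1/2" for t
    using that w0 w2 mult_right_mono[of w "2 * pi" t] by (intro cos_monotone_0_pi_le) auto
  \<comment> \<open>A continuous nonnegative function of integral zero vanishes everywhere; at t =
    1/4 this contradicts w < 2 pi.\<close>
  define f where "f t = 2 * Y * (1 - cos (2 * pi * t)) - chord y t" for t
  have nn: "0 \<le> f t" if t: "0 \<le> t" "t \<le> 1" for t
  proof -
    have h: "0 \<le> f t" if t: "0 \<le> t" "t \<le> 1/2" for t
    proof -
      have "2 * Y * (1 - cos (w * t)) \<le> 2 * Y * (1 - cos (2 * pi * t))"
        using Y0 cmono[OF t] by (intro mult_left_mono) auto
      then show ?thesis using bd[OF t] by (simp add: f_def)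
    qed
    have "f (1 - t) = f t"
      using chord_reflect[OF cont per t] cos_periodic[of "- (2 * pi * t)"]
      by (simp add: f_def algebra_simps)
    then show ?thesis using h[of t] h[of "1 - t"] t by fastforce
  qed
  have fc: "continuous_on {0..1} f"
    unfolding f_def by (intro continuous_intros integral_chord(1)[OF cont per mean])
  have "((\<lambda>t. cos (2 * pi * t)) has_integral (sin (2 * pi * 1) / (2 * pi) - sin (2 * pi * 0) / (2 * pi))) {0..1}"
    by (intro fundamental_theorem_of_calculus)
      (auto intro!: derivative_eq_intros simp flip: has_real_derivative_iff_has_vector_derivative)
  then have "((\<lambda>t. cos (2 * pi * t)) has_integral 0) {0..1}" by simp
  from has_integral_diff[OF has_integral_const_real[of "1::real" 0 1] this]
  have "((\<lambda>t. 1 - cos (2 * pi * t)) has_integral 1) {0..1}" by simp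
  from has_integral_mult_right[OF this, of "2 * Y"]
  have "((\<lambda>t. 2 * Y * (1 - cos (2 * pi * t))) has_integral 2 * Y) {0..1}"
    by (simp only: mult_1_right)
  moreover have "(chord y has_integral 2 * Y) {0..1}"
    using integral_chord[OF cont per mean] integrable_continuous_interval
    by (auto simp: Y_def has_integral_iff)
  ultimately have "(f has_integral (2 * Y - 2 * Y)) {0..1}"
    unfolding f_def by (rule has_integral_diff)
  then have "integral {0..1} f = 0" by (simp add: integral_unique)
  then have "f (1/4) = 0"
    using integral_eq_0_iff[OF fc] nn by auto
  moreover have "cos (2 * pi * (1/4)) < cos (w * (1/4))"
    using w0 w2 by (intro cos_monotone_0_pi) auto
  then have "2 * Y * (1 - cos (w * (1/4))) < 2 * Y * (1 - cos (2 * pi * (1/4)))"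
    using Y0 by (intro mult_strict_left_mono) linarith+
  ultimately show False using bd[of "1/4"] by (simp add: f_def)
qed

lemma chord_le_sin:
  fixes y :: "real \<Rightarrow> 'a::euclidean_space"
  assumes cont: "continuous_on UNIV y" and per: "\<And>x. y (x + 1) = y x"
    and mean: "integral {0..1} y = 0"
    and sq: "\<And>t. 0 \<le> t \<Longrightarrow> t \<le> 1 \<Longrightarrow> chord y t \<le> t\<^sup>2 * P" and P: "0 \<le> P"
    and t: "0 \<le> t" "t \<le> 1"
  shows "chord y t \<le> P * (sin (pi * t))\<^sup>2 / pi\<^sup>2"
proof (cases "P = 0")
  case True
  then show ?thesis using sq[OF t] by simp
next
  case False
  \<comment> \<open>The value of M for which w = 2 pi; \<open>wirtinger\<close> makes it an
    admissible bound for the mean square.\<close>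
  define M where "M = P / (4 * pi\<^sup>2)"
  have M: "0 < M" "P = (2 * pi)\<^sup>2 * M" using P False by (auto simp: M_def)
  have h: "chord y t \<le> P * (sin (pi * t))\<^sup>2 / pi\<^sup>2" if t: "0 \<le> t" "t \<le> 1/2" for t
  proof -
    have "chord y t \<le> 2 * M * (1 - cos (2 * pi * t))"
      using t sq M wirtinger[OF cont per mean sq P] unfolding M_def
      by (intro chord_le_cos[OF cont per]) auto
    also have "1 - cos (2 * pi * t) = 2 * (sin (pi * t))\<^sup>2"
      using cos_double_sin[of "pi * t"] by (simp add: mult.assoc)
    finally show ?thesis by (simp add: M_def field_simps)
  qed
  have "sin (pi * (1 - t)) = sin (pi * t)"
    by (simp add: right_diff_distrib sin_diff)
  then show ?thesis using h[of t] h[of "1 - t"] chord_reflect[OF cont per t] t by fastforce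
qed


section \<open>Weak derivatives and increments\<close>

text \<open>A quadratic spline rising from 0 to 1 on [0,1]. Test functions must be C^1, which rules
  out a piecewise linear ramp. Its derivative \<open>tent\<close> is the hat on [0,1] of height 2
  and integral 1.\<close>

definition ramp :: "real \<Rightarrow> real" where
  "ramp x = 2 * ((max 0 x)\<^sup>2 - 2 * (max 0 (x - 1/2))\<^sup>2 + (max 0 (x - 1))\<^sup>2)"

definition tent :: "real \<Rightarrow> real" where
  "tent x = 4 * (max 0 x - 2 * max 0 (x - 1/2) + max 0 (x - 1))"

lemma has_field_derivative_max_0_squared:
  "((\<lambda>x. (max 0 x)\<^sup>2) has_field_derivative 2 * max 0 x) (at (x::real))"
proof -
  consider "x < 0" | "x = 0" | "x > 0" by linarith
  then show ?thesis
  proof cases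
    case 1
    have "((\<lambda>_. 0) has_field_derivative 2 * max 0 x) (at x)" using 1 by simp
    then show ?thesis
      by (rule has_field_derivative_transform_within_open[where S = "{..<0}"]) (use 1 in auto)
  next
    case 2
    have "((\<lambda>h. (max 0 h)\<^sup>2 / h) \<longlongrightarrow> 0) (at (0::real))"
    proof (rule Lim_null_comparison)
      show "\<forall>\<^sub>F h in at 0. norm ((max 0 h)\<^sup>2 / h) \<le> \<bar>h :: real\<bar>"
        by (intro always_eventually) (auto simp: max_def power2_eq_square)
      show "((\<lambda>h::real. \<bar>h\<bar>) \<longlongrightarrow> 0) (at 0)" by (rule tendsto_rabs_zero) (rule tendsto_ident_at)
    qed
    then show ?thesis using 2 by (simp add: has_field_derivative_iff)
  next
    case 3
    have "((\<lambda>x. x\<^sup>2) has_field_derivative 2 * max 0 x) (at x)" 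
      using 3 by (auto intro!: derivative_eq_intros)
    then show ?thesis
      by (rule has_field_derivative_transform_within_open[where S = "{0<..}"]) (use 3 in auto)
  qed
qed

lemma has_field_derivative_ramp: "(ramp has_field_derivative tent x) (at x)"
proof -
  have d: "((\<lambda>x. (max 0 (x - c))\<^sup>2) has_field_derivative 2 * max 0 (x - c)) (at x)" for c
  proof -
    have "((\<lambda>x. x - c) has_field_derivative 1) (at x)"
      by (auto intro!: derivative_eq_intros)
    from DERIV_chain2[OF has_field_derivative_max_0_squared this] show ?thesis by simp
  qed
  show ?thesis
    unfolding ramp_def [abs_def] tent_def
    by (rule derivative_eq_intros d has_field_derivative_max_0_squared refl | simp)+
qed

lemma continuous_on_tent [continuous_intros]:
  "continuous_on A f \<Longrightarrow> continuous_on A (\<lambda>x. tent (f x))"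
  unfolding tent_def by (intro continuous_intros)

lemma tent_nonneg: "0 \<le> tent x"
  unfolding tent_def by (auto simp: max_def)

lemma tent_eq_0: "x \<le> 0 \<or> 1 \<le> x \<Longrightarrow> tent x = 0"
  unfolding tent_def by (auto simp: max_def)

lemma ramp_eq_0: "x \<le> 0 \<Longrightarrow> ramp x = 0"
  unfolding ramp_def by (auto simp: max_def)

lemma ramp_eq_1: "1 \<le> x \<Longrightarrow> ramp x = 1"
  unfolding ramp_def by (simp add: max_absorb2 power2_diff power_divide)

lemma ramp_mono: "x \<le> y \<Longrightarrow> ramp x \<le> ramp y"
  by (erule DERIV_nonneg_imp_nondecreasing) (blast intro: has_field_derivative_ramp tent_nonneg)

lemma ramp_bounds: "0 \<le> ramp x" "ramp x \<le> 1"
  using ramp_mono[of "min 0 x" x] ramp_mono[of x "max 1 x"] by (auto simp: ramp_eq_0 ramp_eq_1)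

lemma has_field_derivative_ramp_scaled:
  "((\<lambda>t. ramp (n * (t - c))) has_field_derivative n * tent (n * (t - c))) (at t)"
proof -
  have "((\<lambda>t. n * (t - c)) has_field_derivative n) (at t)"
    by (auto intro!: derivative_eq_intros)
  from DERIV_chain2[OF has_field_derivative_ramp this] show ?thesis by (simp add: mult.commute)
qed

text \<open>The scaled tents form an approximate identity, each supported in [c, c + 1/k] to the
  right of c.\<close>

lemma tent_average_tendsto:
  fixes y :: "real \<Rightarrow> 'a::euclidean_space"
  assumes cont: "continuous_on {0..1} y" and c: "0 < c" "c < 1"
  shows "(\<lambda>k. integral {0..1} (\<lambda>t. (real k * tent (real k * (t - c))) *\<^sub>R y t)) \<longlonglongrightarrow> y c"
proof (rule LIMSEQ_I)
  fix e :: real assume e: "e > 0"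
  obtain d where d: "d > 0" "\<And>t. t \<in> {0..1} \<Longrightarrow> dist t c < d \<Longrightarrow> dist (y t) (y c) < e / 2"
    using cont c e unfolding continuous_on_iff by (metis atLeastAtMost_iff half_gt_zero less_imp_le)
  \<comment> \<open>From N on, 1/k < 1 - c keeps the whole bump, hence its unit mass, inside [0,1],
    and 1/k < d lets it see only values of \<open>y\<close> close to \<open>y c\<close>.\<close>
  obtain N where N: "1 / min d (1 - c) < real N" using reals_Archimedean2 by blast
  have "norm (integral {0..1} (\<lambda>t. (real k * tent (real k * (t - c))) *\<^sub>R y t) - y c) < e" if k: "k \<ge> N" for k
  proof -
    define s where "s t = real k * tent (real k * (t - c))" for t
    have k1: "1 / min d (1 - c) < real k" using N k by (meson le_less_trans less_le_trans of_nat_le_iff order_le_less_trans)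
    have "0 < 1 / min d (1 - c)" using d c by simp
    then have k0: "0 < real k" using k1 by linarith
    have "1 < real k * min d (1 - c)" using k1 d c by (simp add: field_simps)
    also have "\<dots> \<le> real k * (1 - c)" by (intro mult_left_mono) auto
    finally have kc: "1 < real k * (1 - c)" .
    have kd: "1 < real k * d"
      using \<open>1 < real k * min d (1 - c)\<close> mult_left_mono[of "min d (1 - c)" d "real k"] by auto
    have sc: "continuous_on A s" for A unfolding s_def by (intro continuous_intros)
    have "(s has_integral (ramp (real k * (1 - c)) - ramp (real k * (0 - c)))) {0..1}"
      unfolding s_def using has_field_derivative_ramp_scaled
      by (intro fundamental_theorem_of_calculus)
        (auto intro: has_field_derivative_at_within simp flip: has_real_derivative_iff_has_vector_derivative)
    then have s1: "(s has_integral 1) {0..1}"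
      using kc c k0 by (simp add: ramp_eq_0 ramp_eq_1 mult_le_0_iff)
    have "integral {0..1} (\<lambda>t. s t *\<^sub>R y t) - y c = integral {0..1} (\<lambda>t. s t *\<^sub>R (y t - y c))"
    proof -
      have "((\<lambda>t. s t *\<^sub>R y c) has_integral 1 *\<^sub>R y c) {0..1}"
        by (rule has_integral_scaleR_left[OF s1])
      moreover have "(\<lambda>t. s t *\<^sub>R y t) integrable_on {0..1}"
        by (intro integrable_continuous_interval continuous_intros sc cont)
      ultimately show ?thesis
        by (simp add: scaleR_diff_right integral_unique has_integral_integrable
            Henstock_Kurzweil_Integration.integral_diff)
    qed
    also have "norm \<dots> \<le> integral {0..1} (\<lambda>t. s t * (e / 2))"
    proof (rule integral_norm_bound_integral)
      show "(\<lambda>t. s t *\<^sub>R (y t - y c)) integrable_on {0..1}" "(\<lambda>t. s t * (e / 2)) integrable_on {0..1}"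
        by (intro integrable_continuous_interval continuous_intros sc cont)+
      fix t :: real assume t: "t \<in> {0..1}"
      have s0: "0 \<le> s t" unfolding s_def using tent_nonneg by simp
      show "norm (s t *\<^sub>R (y t - y c)) \<le> s t * (e / 2)"
      proof (cases "dist t c < d")
        case True
        then have "norm (y t - y c) \<le> e / 2" using d(2)[OF t True] by (simp add: dist_norm)
        from mult_left_mono[OF this s0] s0 show ?thesis by simp
      next
        case False
        then consider "t \<le> c" | "t - c \<ge> d" using d(1) by (fastforce simp: dist_real_def)
        then have "real k * (t - c) \<le> 0 \<or> 1 \<le> real k * (t - c)"
        proof cases
          case 1
          then show ?thesis using k0 by (simp add: mult_le_0_iff)
        next
          case 2
          then have "real k * d \<le> real k * (t - c)" using k0 by (intro mult_left_mono) auto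
          then show ?thesis using kd by linarith
        qed
        then have "s t = 0" unfolding s_def by (simp add: tent_eq_0)
        then show ?thesis by simp
      qed
    qed
    also have "\<dots> = e / 2" by (simp add: integral_unique[OF s1])
    finally show ?thesis using e unfolding s_def by simp
  qed
  then show "\<exists>no. \<forall>k\<ge>no. norm (integral {0..1} (\<lambda>t. (real k * tent (real k * (t - c))) *\<^sub>R y t) - y c) < e"
    by blast
qed

lemma integrable_L2_01:
  fixes g :: "real \<Rightarrow> 'a::euclidean_space"
  assumes "g \<in> L2_01" shows "integrable (lebesgue_on {0..1}) g"
proof (rule Bochner_Integration.integrable_bound)
  have "integrable (lebesgue_on {0..1::real}) (\<lambda>_. 1 :: real)"
    by (rule continuous_imp_integrable_real) (intro continuous_intros)
  then show "integrable (lebesgue_on {0..1}) (\<lambda>t. 1 + (norm (g t))\<^sup>2)"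
    using assms by (intro Bochner_Integration.integrable_add) (auto simp: L2_01_def)
  show "g \<in> borel_measurable (lebesgue_on {0..1})" using assms by (simp add: L2_01_def)
  have "norm (g x) \<le> norm (1 + (norm (g x))\<^sup>2)" for x
  proof -
    have "2 * norm (g x) \<le> 1 + (norm (g x))\<^sup>2"
      using zero_le_power2[of "norm (g x) - 1"] by (simp add: power2_diff)
    moreover have "0 \<le> norm (g x)" by simp
    ultimately have "norm (g x) \<le> 1 + (norm (g x))\<^sup>2" by linarith
    then show ?thesis by simp
  qed
  then show "AE x in lebesgue_on {0..1}. norm (g x) \<le> norm (1 + (norm (g x))\<^sup>2)" by simp
qed

text \<open>The test function is a C^1 approximation of the indicator of (a,b], rising after a and
  falling after b. Its derivative averages y near a and near b, while dominated convergence handles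
  the integral against g.\<close>

lemma weak_deriv_increment_interior:
  fixes y g :: "real \<Rightarrow> 'a::euclidean_space"
  assumes cont: "continuous_on {0..1} y" and g: "g \<in> L2_01" and wd: "has_weak_deriv y g"
    and ab: "0 < a" "a \<le> b" "b < 1"
  shows "y b - y a = integral {a..b} g"
proof -
  define \<phi> where "\<phi> k t = ramp (real k * (t - a)) - ramp (real k * (t - b))" for k t
  define \<phi>' where "\<phi>' k t = real k * tent (real k * (t - a)) - real k * tent (real k * (t - b))" for k t
  have der: "(\<phi> k has_field_derivative \<phi>' k t) (at t)" for k t
    unfolding \<phi>_def [abs_def] \<phi>'_def by (intro derivative_intros has_field_derivative_ramp_scaled)
  have \<phi>_cont: "continuous_on A (\<phi> k)" for A k
    using der by (meson DERIV_isCont continuous_at_imp_continuous_on)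
  have \<phi>_bd: "\<bar>\<phi> k t\<bar> \<le> 1" for k t
    unfolding \<phi>_def using ramp_bounds[of "real k * (t - a)"] ramp_bounds[of "real k * (t - b)"] by linarith
  have gint: "integrable (lebesgue_on {0..1}) g" by (rule integrable_L2_01[OF g])
  \<comment> \<open>The test function is supported in [a, b + 1/k], which lies inside (0,1) once k
    >= N.\<close>
  obtain N where N: "1 / (1 - b) < real N" using reals_Archimedean2 by blast
  have test: "\<phi> k \<in> test_functions" if k: "k \<ge> N" for k
  proof -
    have k1: "1 / (1 - b) < real k" using N k by (meson less_le_trans of_nat_le_iff)
    moreover have "0 < 1 / (1 - b)" using ab by simp
    ultimately have k0: "0 < real k" by linarith
    have kb: "b + 1 / real k < 1" using k1 k0 ab by (simp add: field_simps)
    have "{t. \<phi> k t \<noteq> 0} \<subseteq> {a..b + 1 / real k}"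
    proof (safe, rule ccontr)
      fix t assume ne: "\<phi> k t \<noteq> 0" and "t \<notin> {a..b + 1 / real k}"
      then consider "t < a" | "t > b + 1 / real k" by fastforce
      then have "\<phi> k t = 0"
      proof cases
        case 1
        then show ?thesis unfolding \<phi>_def using ab k0 by (simp add: ramp_eq_0 mult_le_0_iff)
      next
        case 2
        then have "1 \<le> real k * (t - b)" using k0 by (simp add: field_simps)
        moreover have "real k * (t - b) \<le> real k * (t - a)" using ab by (intro mult_left_mono) auto
        ultimately show ?thesis unfolding \<phi>_def by (simp add: ramp_eq_1)
      qed
      then show False using ne by simp
    qed
    then have "closure {t. \<phi> k t \<noteq> 0} \<subseteq> {a..b + 1 / real k}"
      by (rule closure_minimal) simp
    then have "closure {t. \<phi> k t \<noteq> 0} \<subseteq> {0<..<1}" using ab kb by auto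
    moreover have "\<phi> k C1_differentiable_on UNIV"
      unfolding C1_differentiable_on_def
    proof (intro exI[of _ "\<phi>' k"] conjI ballI)
      show "(\<phi> k has_vector_derivative \<phi>' k t) (at t)" for t
        using der by (simp flip: has_real_derivative_iff_has_vector_derivative)
      show "continuous_on UNIV (\<phi>' k)"
        unfolding \<phi>'_def [abs_def] by (intro continuous_intros)
    qed
    ultimately show ?thesis unfolding test_functions_def by simp
  qed
  have lhs: "(LINT t|lebesgue_on {0..1}. deriv (\<phi> k) t *\<^sub>R y t) =
      integral {0..1} (\<lambda>t. (real k * tent (real k * (t - a))) *\<^sub>R y t) -
      integral {0..1} (\<lambda>t. (real k * tent (real k * (t - b))) *\<^sub>R y t)" for k
  proof -
    have "deriv (\<phi> k) = \<phi>' k" using der DERIV_imp_deriv by blast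
    moreover have "continuous_on {0..1} (\<lambda>t. \<phi>' k t *\<^sub>R y t)"
      unfolding \<phi>'_def by (intro continuous_intros cont)
    ultimately have "(LINT t|lebesgue_on {0..1}. deriv (\<phi> k) t *\<^sub>R y t) = integral {0..1} (\<lambda>t. \<phi>' k t *\<^sub>R y t)"
      by (simp add: lebesgue_integral_eq_integral continuous_imp_integrable_real)
    also have "\<dots> = integral {0..1} (\<lambda>t. (real k * tent (real k * (t - a))) *\<^sub>R y t) -
      integral {0..1} (\<lambda>t. (real k * tent (real k * (t - b))) *\<^sub>R y t)"
      unfolding \<phi>'_def scaleR_diff_left
      by (intro Henstock_Kurzweil_Integration.integral_diff integrable_continuous_interval continuous_intros cont)
    finally show ?thesis .
  qed
  have "(\<lambda>k. LINT t|lebesgue_on {0..1}. deriv (\<phi> k) t *\<^sub>R y t) \<longlonglongrightarrow> y a - y b"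
    unfolding lhs using ab by (intro tendsto_diff tent_average_tendsto[OF cont]) auto
  then have L: "(\<lambda>k. LINT t|lebesgue_on {0..1}. deriv (\<phi> (k + N)) t *\<^sub>R y t) \<longlonglongrightarrow> y a - y b"
    by (rule LIMSEQ_ignore_initial_segment)
  have "(\<lambda>k. LINT t|lebesgue_on {0..1}. \<phi> k t *\<^sub>R g t) \<longlonglongrightarrow> (LINT t|lebesgue_on {0..1}. indicator {a<..b} t *\<^sub>R g t)"
  proof (rule integral_dominated_convergence[where w = "\<lambda>t. norm (g t)"])
    have gm [measurable]: "g \<in> borel_measurable (lebesgue_on {0..1})" using gint by auto
    show "(\<lambda>t. indicator {a<..b} t *\<^sub>R g t) \<in> borel_measurable (lebesgue_on {0..1})"
      by (intro borel_measurable_scaleR gm borel_measurable_indicator) (use ab in \<open>auto simp: sets_restrict_space_iff\<close>)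
    show "(\<lambda>t. \<phi> k t *\<^sub>R g t) \<in> borel_measurable (lebesgue_on {0..1})" for k
      by (intro borel_measurable_scaleR gm continuous_imp_measurable_on_sets_lebesgue \<phi>_cont) auto
    show "integrable (lebesgue_on {0..1}) (\<lambda>t. norm (g t))" using gint by simp
    show "AE t in lebesgue_on {0..1}. norm (\<phi> k t *\<^sub>R g t) \<le> norm (g t)" for k
      using mult_right_mono[OF \<phi>_bd norm_ge_zero] by (intro AE_I2) simp
    \<comment> \<open>The scaled ramp at c vanishes at t = c for every k, so its limit is the
      indicator of the open half line, and the difference is that of the half-open interval.\<close>
    have "(\<lambda>k. \<phi> k t) \<longlonglongrightarrow> indicator {a<..b} t" for t
    proof -
      have r: "(\<lambda>k. ramp (real k * (t - c))) \<longlonglongrightarrow> indicator {c<..} t" for c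
      proof (cases "c < t")
        case True
        obtain K where K: "1 / (t - c) < real K" using reals_Archimedean2 by blast
        have "ramp (real k * (t - c)) = 1" if "k \<ge> K" for k
        proof -
          have "1 / (t - c) < real k" using K that by (meson less_le_trans of_nat_le_iff)
          then show ?thesis using True by (intro ramp_eq_1) (simp add: field_simps)
        qed
        then have "eventually (\<lambda>k. ramp (real k * (t - c)) = 1) sequentially"
          using eventually_sequentially by blast
        then show ?thesis using True by (simp add: tendsto_eventually)
      next
        case False
        then show ?thesis by (simp add: ramp_eq_0 mult_le_0_iff)
      qed
      have "indicator {a<..b} t = (indicator {a<..} t - indicator {b<..} t :: real)"
        using ab by (auto simp: indicator_def)
      then show ?thesis unfolding \<phi>_def using tendsto_diff[OF r r] by simp
    qed
    then show "AE t in lebesgue_on {0..1}. (\<lambda>k. \<phi> k t *\<^sub>R g t) \<longlonglongrightarrow> indicator {a<..b} t *\<^sub>R g t"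
      by (intro AE_I2 tendsto_scaleR tendsto_const)
  qed
  then have "(\<lambda>k. LINT t|lebesgue_on {0..1}. \<phi> (k + N) t *\<^sub>R g t) \<longlonglongrightarrow> (LINT t|lebesgue_on {0..1}. indicator {a<..b} t *\<^sub>R g t)"
    by (rule LIMSEQ_ignore_initial_segment)
  then have "(\<lambda>k. LINT t|lebesgue_on {0..1}. deriv (\<phi> (k + N)) t *\<^sub>R y t) \<longlonglongrightarrow> - (LINT t|lebesgue_on {0..1}. indicator {a<..b} t *\<^sub>R g t)"
    using wd test unfolding has_weak_deriv_def by (simp add: tendsto_minus)
  with L have "y a - y b = - (LINT t|lebesgue_on {0..1}. indicator {a<..b} t *\<^sub>R g t)"
    using LIMSEQ_unique by blast
  also have "(LINT t|lebesgue_on {0..1}. indicator {a<..b} t *\<^sub>R g t) = integral {0..1} (\<lambda>t. indicator {a<..b} t *\<^sub>R g t)"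
    by (intro lebesgue_integral_eq_integral integrable_mult_indicator gint) (use ab in \<open>auto simp: sets_restrict_space_iff\<close>)
  also have "\<dots> = integral {0..1} (\<lambda>t. if t \<in> {a..b} then g t else 0)"
    by (rule integral_spike[of "{a}"]) (auto simp: indicator_def)
  also have "\<dots> = integral {a..b} g"
    using ab by (subst Henstock_Kurzweil_Integration.integral_restrict_Int)
      (auto intro!: arg_cong[where f = "\<lambda>S. integral S g"])
  finally show ?thesis by (simp add: algebra_simps)
qed

lemma integrable_on_L2_01:
  fixes g :: "real \<Rightarrow> 'a::euclidean_space"
  assumes "g \<in> L2_01"
  shows "g absolutely_integrable_on {0..1}" "(\<lambda>t. (norm (g t))\<^sup>2) absolutely_integrable_on {0..1}"
proof -
  show "g absolutely_integrable_on {0..1}"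
    using integrable_L2_01[OF assms]
    by (simp add: absolutely_integrable_on_def integrable_on_lebesgue_on)
  have "(\<lambda>t. (norm (g t))\<^sup>2) integrable_on {0..1}"
    using assms by (simp add: L2_01_def integrable_on_lebesgue_on)
  then show "(\<lambda>t. (norm (g t))\<^sup>2) absolutely_integrable_on {0..1}"
    by (simp add: absolutely_integrable_on_def)
qed

text \<open>Test functions do not reach the end points. The difference of y and the indefinite
  integral of g is constant on the open interval, and continuity extends this to the closed
  one.\<close>

lemma weak_deriv_increment:
  fixes y g :: "real \<Rightarrow> 'a::euclidean_space"
  assumes cont: "continuous_on {0..1} y" and g: "g \<in> L2_01" and wd: "has_weak_deriv y g"
    and ab: "0 \<le> a" "a \<le> b" "b \<le> 1"
  shows "y b - y a = integral {a..b} g"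
proof -
  have gi: "g integrable_on {0..1}" using integrable_on_L2_01[OF g] set_lebesgue_integral_eq_integral(1) by blast
  define h where "h x = y x - integral {0..x} g" for x
  have hc: "continuous_on {0..1} h"
    unfolding h_def by (intro continuous_intros cont indefinite_integral_continuous_1 gi)
  have sub: "integral {0..u} g + integral {u..v} g = integral {0..v} g" if "0 \<le> u" "u \<le> v" "v \<le> 1" for u v
    using that by (intro Henstock_Kurzweil_Integration.integral_combine integrable_on_subinterval[OF gi]) auto
  have eq: "h u = h (1/2)" if "u \<in> {0<..<1}" for u
  proof -
    have "h u = h v" if "0 < u" "u \<le> v" "v < 1" for u v
      using weak_deriv_increment_interior[OF cont g wd that] sub[of u v] that
      by (simp add: h_def algebra_simps)
    from this[of u "1/2"] this[of "1/2" u] that show ?thesis by fastforce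
  qed
  have eq': "h u = h (1/2)" if "u \<in> {0..1}" for u
  proof (rule continuous_constant_on_closure[of "{0<..<1}"])
    show "h t = h (1/2)" if "t \<in> {0<..<1}" for t
      by (rule eq[OF that])
  qed (use hc that in auto)
  have "y b - y a = integral {0..b} g - integral {0..a} g + (h b - h a)"
    by (simp add: h_def)
  also have "h b - h a = 0"
    using eq'[of a] eq'[of b] ab by simp
  also have "integral {0..b} g = integral {0..a} g + integral {a..b} g"
    using sub[of a b] ab by simp
  finally show ?thesis by simp
qed


section \<open>Chords and energy\<close>

text \<open>Cauchy-Schwarz in the form that the variance of g, the integral of its squared distance
  from its mean value over [a,b], is nonnegative.\<close>

lemma norm_integral_squared_le:
  fixes g :: "real \<Rightarrow> 'a::euclidean_space"
  assumes g: "g integrable_on {a..b}" and g2: "(\<lambda>t. (norm (g t))\<^sup>2) integrable_on {a..b}" and ab: "a \<le> b"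
  shows "(norm (integral {a..b} g))\<^sup>2 \<le> (b - a) * integral {a..b} (\<lambda>t. (norm (g t))\<^sup>2)"
proof (cases "a = b")
  case False
  define L where "L = b - a"
  have L: "0 < L" using ab False by (simp add: L_def)
  define u where "u = integral {a..b} g"
  have eq: "(norm (g t - (1 / L) *\<^sub>R u))\<^sup>2 = (norm (g t))\<^sup>2 - 2 / L * (g t \<bullet> u) + (norm u)\<^sup>2 / L\<^sup>2" for t
    unfolding power2_norm_eq_inner by (simp add: inner_commute algebra_simps power2_eq_square)
  have gu: "((\<lambda>t. g t \<bullet> u) has_integral (norm u)\<^sup>2) {a..b}"
    using has_integral_linear[OF integrable_integral[OF g] bounded_linear_inner_left[of u]]
    by (simp add: o_def u_def power2_norm_eq_inner)
  have "((\<lambda>t. (norm (g t - (1 / L) *\<^sub>R u))\<^sup>2) has_integral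
      (integral {a..b} (\<lambda>t. (norm (g t))\<^sup>2) - 2 / L * (norm u)\<^sup>2 + L * ((norm u)\<^sup>2 / L\<^sup>2))) {a..b}"
    unfolding eq using has_integral_const_real[of "(norm u)\<^sup>2 / L\<^sup>2" a b] ab
    by (intro has_integral_add has_integral_diff integrable_integral[OF g2] has_integral_mult_right[OF gu])
      (simp add: L_def)
  then have "0 \<le> integral {a..b} (\<lambda>t. (norm (g t))\<^sup>2) - 2 / L * (norm u)\<^sup>2 + L * ((norm u)\<^sup>2 / L\<^sup>2)"
    by (rule has_integral_nonneg) simp
  also have "\<dots> = integral {a..b} (\<lambda>t. (norm (g t))\<^sup>2) - (norm u)\<^sup>2 / L"
    using L by (simp add: field_simps power2_eq_square)
  finally show ?thesis using L by (simp add: field_simps u_def flip: L_def)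
qed simp

text \<open>Bounds of the form length times energy add up along consecutive pieces. This serves
  chords that cross the end of the period and must be cut there.\<close>

lemma norm_add_squared_le:
  fixes u w :: "'a::real_normed_vector"
  assumes u: "(norm u)\<^sup>2 \<le> p * \<alpha>" and w: "(norm w)\<^sup>2 \<le> q * \<beta>"
    and nn: "0 \<le> p" "0 \<le> q" "0 \<le> \<alpha>" "0 \<le> \<beta>"
  shows "(norm (u + w))\<^sup>2 \<le> (p + q) * (\<alpha> + \<beta>)"
proof -
  have "(2 * norm u * norm w)\<^sup>2 = 4 * ((norm u)\<^sup>2 * (norm w)\<^sup>2)"
    by (simp add: power_mult_distrib)
  also have "\<dots> \<le> 4 * ((p * \<alpha>) * (q * \<beta>))"
    using u w nn by (intro mult_left_mono mult_mono) auto
  also have "\<dots> \<le> (p * \<beta> + q * \<alpha>)\<^sup>2"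
    using zero_le_power2[of "p * \<beta> - q * \<alpha>"] by (simp add: power2_eq_square algebra_simps)
  finally have "2 * norm u * norm w \<le> p * \<beta> + q * \<alpha>"
    by (rule power2_le_imp_le) (use nn in auto)
  moreover have "(norm (u + w))\<^sup>2 \<le> (norm u + norm w)\<^sup>2"
    by (intro power_mono norm_triangle_ineq) auto
  moreover have "(norm u + norm w)\<^sup>2 = (norm u)\<^sup>2 + (norm w)\<^sup>2 + 2 * norm u * norm w"
    by (rule power2_sum)
  moreover have "(p + q) * (\<alpha> + \<beta>) = p * \<alpha> + q * \<beta> + (p * \<beta> + q * \<alpha>)"
    by (simp add: algebra_simps)
  ultimately show ?thesis using u w by linarith
qed

text \<open>Each squared chord is at most t times the energy spent between s and s + t; on averaging
  over s, every point of the period is counted with weight t.\<close>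

lemma chord_le_energy:
  fixes y g :: "real \<Rightarrow> 'a::euclidean_space"
  assumes cont: "continuous_on UNIV y" and per: "\<And>x. y (x + 1) = y x"
    and g: "g \<in> L2_01" and wd: "has_weak_deriv y g" and t: "0 \<le> t" "t \<le> 1"
  shows "chord y t \<le> t\<^sup>2 * integral {0..1} (\<lambda>s. (norm (g s))\<^sup>2)"
proof -
  define P where "P = integral {0..1} (\<lambda>s. (norm (g s))\<^sup>2)"
  define N where "N x = integral {0..x} (\<lambda>s. (norm (g s))\<^sup>2)" for x
  \<comment> \<open>\<open>g\<close> is controlled on [0,1] only, so the accumulated energy
    \<open>N\<close> is continued past 1 by another period. Then \<open>N' (s + t) - N' s\<close> is
    the energy between s and s + t also across the period end.\<close>
  define N' where "N' x = (if x \<le> 1 then N x else N (x - 1) + P)" for x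
  have gi: "g integrable_on {0..1}" and g2i: "(\<lambda>s. (norm (g s))\<^sup>2) integrable_on {0..1}"
    using integrable_on_L2_01[OF g] set_lebesgue_integral_eq_integral(1) by blast+
  have gi': "g integrable_on {a..b}" and g2i': "(\<lambda>s. (norm (g s))\<^sup>2) integrable_on {a..b}"
    if "0 \<le> a" "b \<le> 1" for a b
    using that by (auto intro: integrable_on_subinterval[OF gi] integrable_on_subinterval[OF g2i])
  have Ndiff: "N a + integral {a..b} (\<lambda>s. (norm (g s))\<^sup>2) = N b" if "0 \<le> a" "a \<le> b" "b \<le> 1" for a b
    unfolding N_def using that
    by (intro Henstock_Kurzweil_Integration.integral_combine g2i') auto
  have Nmono: "N a \<le> N b" if "0 \<le> a" "a \<le> b" "b \<le> 1" for a b
    using Ndiff[OF that] Henstock_Kurzweil_Integration.integral_nonneg[OF g2i'[of a b]] that by auto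
  have N01: "N 0 = 0" "N 1 = P" by (auto simp: N_def P_def)
  have inc: "(norm (y b - y a))\<^sup>2 \<le> (b - a) * (N b - N a)" if "0 \<le> a" "a \<le> b" "b \<le> 1" for a b
  proof -
    have "integral {a..b} (\<lambda>s. (norm (g s))\<^sup>2) = N b - N a" using Ndiff[OF that] by simp
    moreover have "y b - y a = integral {a..b} g"
      using weak_deriv_increment[OF continuous_on_subset[OF cont] g wd that] by simp
    ultimately show ?thesis using norm_integral_squared_le[OF gi' g2i', of a b] that by simp
  qed
  have inc': "(norm (y (s + t) - y s))\<^sup>2 \<le> t * (N' (s + t) - N' s)" if s: "s \<in> {0..1}" for s
  proof (cases "s + t \<le> 1")
    case True
    then show ?thesis using inc[of s "s + t"] s t by (simp add: N'_def)
  next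
    case False
    have eq: "y (s + t) - y s = (y (s + t - 1) - y 0) + (y 1 - y s)"
      using per[of "s + t - 1"] per[of 0] by simp
    have "(norm (y (s + t - 1) - y 0))\<^sup>2 \<le> (s + t - 1) * N (s + t - 1)"
      using inc[of 0 "s + t - 1"] False s t N01 by simp
    moreover have "(norm (y 1 - y s))\<^sup>2 \<le> (1 - s) * (P - N s)"
      using inc[of s 1] s N01 by simp
    ultimately have "(norm (y (s + t) - y s))\<^sup>2 \<le> (s + t - 1 + (1 - s)) * (N (s + t - 1) + (P - N s))"
      unfolding eq
      using norm_add_squared_le[of "y (s + t - 1) - y 0" "s + t - 1" "N (s + t - 1)" "y 1 - y s" "1 - s" "P - N s"]
        False s t Nmono[of 0 "s + t - 1"] Nmono[of s 1] N01 by fastforce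
    then show ?thesis using False s by (simp add: N'_def algebra_simps)
  qed
  have Nc: "continuous_on {0..1} N"
    unfolding N_def by (intro indefinite_integral_continuous_1 g2i)
  have N'c: "continuous_on {0..2} N'"
  proof -
    have "continuous_on ({0..1} \<union> {1..2}) (\<lambda>x. if x \<le> 1 then N x else N (x - 1) + P)"
    proof (rule continuous_on_cases)
      show "continuous_on {1..2} (\<lambda>x. N (x - 1) + P)"
        by (intro continuous_intros continuous_on_compose2[OF Nc]) auto
    qed (use Nc N01 in auto)
    moreover have "{0..1} \<union> {1..2} = {0..2::real}" by auto
    ultimately show ?thesis by (simp add: N'_def [abs_def])
  qed
  have N'i: "N' integrable_on {a..b}" if "0 \<le> a" "b \<le> 2" for a b
    using that by (intro integrable_continuous_interval continuous_on_subset[OF N'c]) auto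
  \<comment> \<open>Moving the window by t trades \<open>N'\<close> on [0,t] for \<open>N'\<close>
    on [1,1+t], where it is larger by P, so the integral gains t P.\<close>
  have s1: "integral {0..1} (\<lambda>s. N' (s + t)) = integral {t..1 + t} N'"
    using integral_shift[of 0 t 1 N'] t continuous_on_subset[OF N'c, of "{t..1 + t}"] by (simp add: o_def)
  have s2: "integral {1..1 + t} N' = integral {0..t} (\<lambda>s. N' (s + 1))"
    using integral_shift[of 0 1 t N'] t continuous_on_subset[OF N'c, of "{1..t + 1}"]
    by (simp add: o_def add.commute)
  have "integral {0..t} (\<lambda>s. N' (s + 1)) = integral {0..t} (\<lambda>s. N' s + P)"
    by (rule Henstock_Kurzweil_Integration.integral_cong) (use t N01 in \<open>auto simp: N'_def\<close>)
  also have "\<dots> = integral {0..t} N' + t * P"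
    using t by (subst Henstock_Kurzweil_Integration.integral_add) (auto intro: N'i)
  finally have "integral {0..1} (\<lambda>s. N' (s + t)) = integral {0..1} N' + t * P"
    using Henstock_Kurzweil_Integration.integral_combine[of t 1 "1 + t" N'] 
      Henstock_Kurzweil_Integration.integral_combine[of 0 t 1 N'] s1 s2 N'i t by simp
  moreover have shi: "(\<lambda>s. N' (s + t)) integrable_on {0..1}"
    using t by (intro integrable_continuous_interval continuous_on_compose2[OF N'c] continuous_intros) auto
  ultimately have "integral {0..1} (\<lambda>s. t * (N' (s + t) - N' s)) = t * (t * P)"
    by (simp add: Henstock_Kurzweil_Integration.integral_diff N'i)
  moreover have "chord y t \<le> integral {0..1} (\<lambda>s. t * (N' (s + t) - N' s))"
    unfolding chord_def
  proof (rule integral_le[OF _ _ inc'])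
    show "(\<lambda>s. (norm (y (s + t) - y s))\<^sup>2) integrable_on {0..1}"
      by (intro integrable_continuous_interval continuous_intros continuous_comp_shift[OF cont]
          continuous_on_subset[OF cont]) auto
    show "(\<lambda>s. t * (N' (s + t) - N' s)) integrable_on {0..1}"
      using shi by (intro integrable_on_mult_right integrable_diff N'i) auto
  qed
  ultimately have "chord y t \<le> t * (t * P)" by linarith
  then show ?thesis unfolding P_def [symmetric] by (simp add: power2_eq_square mult.assoc)
qed

section \<open>Continuity and periodicity of the admissible curves\<close>

lemma periodic_add_of_int:
  fixes y :: "real \<Rightarrow> 'a"
  assumes per: "\<And>x. y (x + 1) = y x"
  shows "y (x + of_int n) = y x"
proof -
  have nat: "y (x + of_nat k) = y x" for x k
  proof (induction k)
    case (Suc k)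
    then show ?case using per[of "x + real k"] by (simp add: add_ac)
  qed simp
  show ?thesis
  proof (cases n)
    case (nonneg k)
    then show ?thesis using nat[of x k] by simp
  next
    case (neg k)
    then have "x + real_of_int n = x - real (Suc k)" by simp
    then show ?thesis using nat[of "x - real (Suc k)" "Suc k"] by (metis diff_add_cancel)
  qed
qed

lemma continuous_on_UNIV_periodic:
  fixes y :: "real \<Rightarrow> 'a::topological_space"
  assumes per: "\<And>x. y (x + 1) = y x" and cont: "continuous_on {0..1} y"
  shows "continuous_on UNIV y"
proof -
  \<comment> \<open>Two periods are glued so that 0, where consecutive periods meet, becomes an
    interior point; every x is then moved into (-1,1) by its floor.\<close>
  have "continuous_on {-1..1} y"
  proof -
    have "continuous_on {-1..0} (\<lambda>x. y (x + 1))"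
      by (intro continuous_on_compose2[OF cont] continuous_intros) auto
    then have "continuous_on {-1..0} y" by (simp add: per)
    then have "continuous_on ({-1..0} \<union> {0..1}) y"
      using cont by (intro continuous_on_closed_Un) auto
    then show ?thesis by (simp add: ivl_disj_un_two_touch)
  qed
  then have c: "isCont y x" if "x \<in> {-1<..<1}" for x
    using that by (intro continuous_on_interior[of "{-1..1}"]) auto
  have "isCont y x" for x
  proof -
    have "isCont (\<lambda>u. u + of_int (- \<lfloor>x\<rfloor>)) x" by (intro continuous_intros)
    moreover have "isCont y (x + of_int (- \<lfloor>x\<rfloor>))"
      by (rule c) (auto, linarith+)
    ultimately have "isCont (\<lambda>u. y (u + of_int (- \<lfloor>x\<rfloor>))) x"
      using isCont_o2 by blast
    then show ?thesis by (simp only: periodic_add_of_int[of y, OF per])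
  qed
  then show ?thesis by (simp add: continuous_at_imp_continuous_on)
qed

lemma weak_deriv_spec:
  assumes "y \<in> H1_01" shows "weak_deriv y \<in> L2_01" "has_weak_deriv y (weak_deriv y)"
  using someI_ex[of "\<lambda>g. g \<in> L2_01 \<and> has_weak_deriv y g"] assms
  unfolding weak_deriv_def H1_01_def by auto

lemma LambdaD:
  assumes "y \<in> Lambda"
  shows "y (x + 1) = y x" "y \<in> H1_01" "continuous_on UNIV y" "integral {0..1} y = 0"
proof -
  show per: "y (x + 1) = y x" for x using assms by (simp add: Lambda_def H1_periodic_def)
  show "y \<in> H1_01" using assms by (simp add: Lambda_def H1_periodic_def)
  then have c: "continuous_on {0..1} y" by (simp add: H1_01_def)
  show "continuous_on UNIV y" by (rule continuous_on_UNIV_periodic[OF per c])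
  show "integral {0..1} y = 0"
    using assms lebesgue_integral_eq_integral[OF continuous_imp_integrable_real[OF c]]
    by (simp add: Lambda_def)
qed

lemma chord_le_energy_sin:
  assumes y: "y \<in> Lambda" and t: "0 \<le> t" "t \<le> 1"
  shows "chord y t \<le> integral {0..1} (\<lambda>s. (norm (weak_deriv y s))\<^sup>2) * (sin (pi * t))\<^sup>2 / pi\<^sup>2"
proof (rule chord_le_sin)
  note L = LambdaD[OF y]
  note g = weak_deriv_spec[OF L(2)]
  show "0 \<le> integral {0..1} (\<lambda>s. (norm (weak_deriv y s))\<^sup>2)"
    using integrable_on_L2_01[OF g(1)] set_lebesgue_integral_eq_integral(1)
    by (intro Henstock_Kurzweil_Integration.integral_nonneg) auto
qed (use LambdaD[OF y] chord_le_energy[OF LambdaD(3)[OF y] LambdaD(1)[OF y] weak_deriv_spec[OF LambdaD(2)[OF y]]] t in auto)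


section \<open>Integration over the unit interval\<close>

text \<open>A crude bound that suffices to dominate the kernel by t^(-\<sigma>). Up to t = 1/3 the
  function sin x - x/2 increases, as cos x >= 1/2; beyond, sin(pi t) is at least sin(pi/6) =
  1/2.\<close>

lemma half_le_sin_pi:
  assumes "0 \<le> t" "t \<le> 1/2" shows "t / 2 \<le> sin (pi * t)"
proof (cases "t \<le> 1/3")
  case True
  have "sin 0 - 0 / 2 \<le> sin (pi * t) - pi * t / 2"
  proof (rule DERIV_nonneg_imp_nondecreasing[where f = "\<lambda>x. sin x - x / 2"])
    show "0 \<le> pi * t" using assms by simp
    fix x assume x: "0 \<le> x" "x \<le> pi * t"
    have "x \<le> pi / 3" using x(2) mult_left_mono[OF True pi_ge_zero] by linarith
    then have "cos (pi / 3) \<le> cos x" using x by (intro cos_monotone_0_pi_le) auto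
    then have "0 \<le> cos x - 1 / 2" by (simp add: cos_60)
    moreover have "((\<lambda>x. sin x - x / 2) has_real_derivative cos x - 1 / 2) (at x)"
      by (auto intro!: derivative_eq_intros)
    ultimately show "\<exists>y. ((\<lambda>x. sin x - x / 2) has_real_derivative y) (at x) \<and> 0 \<le> y" by blast
  qed
  moreover have "1 * t \<le> pi * t" using assms pi_ge_two by (intro mult_right_mono) auto
  ultimately show ?thesis by simp
next
  case False
  have "sin (pi / 6) \<le> sin (pi * t)"
    using False assms by (intro sin_monotone_2pi_le) auto
  then show ?thesis using assms by (simp add: sin_30)
qed

text \<open>The interaction of two points of the unit circle at parameter distance t. At t = 0 and t
  = 1 real division by zero gives 0 rather than infinity, which affects a null set only.\<close>

definition circle_kernel :: "real \<Rightarrow> real \<Rightarrow> real" where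
  "circle_kernel \<sigma> t = 1 / (2 * sin (pi * t)) powr \<sigma>"

lemma circle_kernel_nonneg: "0 \<le> circle_kernel \<sigma> t"
  by (simp add: circle_kernel_def)

lemma measurable_circle_kernel [measurable]: "circle_kernel \<sigma> \<in> borel_measurable borel"
  unfolding circle_kernel_def by measurable

lemma circle_kernel_reflect: "circle_kernel \<sigma> (1 - t) = circle_kernel \<sigma> t"
  by (simp add: circle_kernel_def right_diff_distrib sin_diff)

lemma circle_kernel_le:
  assumes \<sigma>: "0 < \<sigma>" and t: "0 \<le> t" "t \<le> 1"
  shows "circle_kernel \<sigma> t \<le> t powr (- \<sigma>) + (1 - t) powr (- \<sigma>)"
proof -
  have half: "circle_kernel \<sigma> t \<le> t powr (- \<sigma>)" if "0 \<le> t" "t \<le> 1/2" for t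
  proof (cases "t = 0")
    case False
    have "t powr \<sigma> \<le> (2 * sin (pi * t)) powr \<sigma>"
      using half_le_sin_pi[OF that] that \<sigma> by (intro powr_mono2) auto
    then show ?thesis
      using False that \<sigma> by (simp add: circle_kernel_def powr_minus_divide frac_le)
  qed (simp add: circle_kernel_def)
  show ?thesis
  proof (cases "t \<le> 1/2")
    case True
    then show ?thesis using half[OF t(1)] by (intro add_increasing2) auto
  next
    case False
    then show ?thesis
      using half[of "1 - t"] t circle_kernel_reflect[of \<sigma> t] by (intro add_increasing) auto
  qed
qed

lemma integrable_circle_kernel:
  assumes \<sigma>: "0 < \<sigma>" "\<sigma> < 1"
  shows "integrable (lebesgue_on {0..1}) (circle_kernel \<sigma>)"
proof (rule Bochner_Integration.integrable_bound)
  have leb: "integrable (lebesgue_on {0..1}) f"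
    if "f integrable_on {0..1}" "\<And>t. 0 \<le> f t" for f :: "real \<Rightarrow> real"
    using that absolutely_integrable_on_iff_nonneg[of "{0..1}" f]
    by (simp add: integrable_restrict_space set_integrable_def)
  have p: "(\<lambda>t. t powr (- \<sigma>)) integrable_on {0..1}"
    using integrable_on_powr_from_0[of "- \<sigma>" 1] \<sigma> by simp
  have im: "(\<lambda>x. 1 - x) ` {0..1} = {0..1::real}"
    by (auto simp: image_iff intro: bexI[where x = "1 - _"])
  have q: "(\<lambda>t. (1 - t) powr (- \<sigma>)) integrable_on {0..1}"
    using integrable_affinity[of "\<lambda>t. t powr (- \<sigma>)" 0 1 "-1" 1] p im by (simp add: add.commute)
  show "integrable (lebesgue_on {0..1}) (\<lambda>t. t powr (- \<sigma>) + (1 - t) powr (- \<sigma>))"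
    by (intro Bochner_Integration.integrable_add leb p q) auto
  show "circle_kernel \<sigma> \<in> borel_measurable (lebesgue_on {0..1})"
    by (intro measurable_restrict_space1 measurable_completion) measurable
  show "AE t in lebesgue_on {0..1}. norm (circle_kernel \<sigma> t) \<le> norm (t powr (- \<sigma>) + (1 - t) powr (- \<sigma>))"
    using circle_kernel_le[OF \<sigma>(1)] circle_kernel_nonneg by (intro AE_I2) auto
qed

text \<open>Borel sets replace Lebesgue sets here: the curves are continuous, so the pair integrands
  are jointly Borel measurable and Tonelli's theorem applies, while nonnegative integrals keep their
  values.\<close>

abbreviation unit_ivl :: "real measure" where
  "unit_ivl \<equiv> restrict_space lborel {0..1}"

lemma nn_integral_lebesgue_on_unit:
  "(\<integral>\<^sup>+ x. f x \<partial>lebesgue_on {0..1}) = (\<integral>\<^sup>+ x. f x \<partial>unit_ivl)"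
  by (simp add: nn_integral_restrict_space nn_integral_completion)

lemma measurable_unit_ivl [measurable (raw)]:
  "f \<in> measurable borel N \<Longrightarrow> f \<in> measurable unit_ivl N"
  by (simp add: measurable_restrict_space1)

lemma emeasure_unit_ivl: "emeasure unit_ivl (space unit_ivl) = 1"
  by (simp add: emeasure_restrict_space space_restrict_space)

interpretation unit_ivl: finite_measure unit_ivl
  by (rule finite_measureI) (simp only: emeasure_unit_ivl, simp)

interpretation unit_ivl2: pair_sigma_finite unit_ivl unit_ivl ..

lemma nn_integral_unit_ivl_circle_kernel:
  assumes \<sigma>: "0 < \<sigma>" "\<sigma> < 1"
  shows "(\<integral>\<^sup>+ t. ennreal (circle_kernel \<sigma> t) \<partial>unit_ivl) = ennreal (LINT t|lebesgue_on {0..1}. circle_kernel \<sigma> t)"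
  using nn_integral_eq_integral[OF integrable_circle_kernel[OF \<sigma>]] circle_kernel_nonneg
  by (simp add: nn_integral_lebesgue_on_unit)

lemma nn_integral_unit_ivl_continuous:
  assumes cont: "continuous_on {0..1} f" and nn: "\<And>t. t \<in> {0..1} \<Longrightarrow> 0 \<le> f t"
  shows "(\<integral>\<^sup>+ t. ennreal (f t) \<partial>unit_ivl) = ennreal (integral {0..1} f)"
  using nn_integral_has_integral_lebesgue'[of "{0..1}" f "integral {0..1} f"] nn
    integrable_integral[OF integrable_continuous_interval[OF cont]]
  by (simp add: nn_integral_restrict_space)

text \<open>The counterpart of \<open>integral_periodic_shift\<close> for extended values, since the
  pair kernel is infinite at collisions.\<close>

lemma nn_integral_periodic_shift:
  fixes f :: "real \<Rightarrow> ennreal"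
  assumes [measurable]: "f \<in> borel_measurable borel" and per: "\<And>x. f (x + 1) = f x"
    and s: "0 \<le> s" "s \<le> 1"
  shows "(\<integral>\<^sup>+ t. f (s + t) \<partial>unit_ivl) = (\<integral>\<^sup>+ t. f t \<partial>unit_ivl)"
proof -
  \<comment> \<open>Half-open intervals make the pieces of the shifted period disjoint, so the two
    indicators add up exactly.\<close>
  have "(\<integral>\<^sup>+ t. f (s + t) \<partial>unit_ivl) = (\<integral>\<^sup>+ t. f (s + t) * indicator {0<..1} t \<partial>lborel)"
    using AE_lborel_singleton[of 0]
    by (auto simp: nn_integral_restrict_space indicator_def intro!: nn_integral_cong_AE elim!: eventually_mono)
  also have "\<dots> = (\<integral>\<^sup>+ r. f r * indicator {s<..s + 1} r \<partial>lborel)"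
    by (subst (2) nn_integral_real_affine[where c = 1 and t = s])
      (auto simp: indicator_def intro!: nn_integral_cong)
  also have "\<dots> = (\<integral>\<^sup>+ r. f r * indicator {s<..1} r + f r * indicator {1<..s + 1} r \<partial>lborel)"
    using s by (auto simp: indicator_def intro!: nn_integral_cong)
  also have "\<dots> = (\<integral>\<^sup>+ r. f r * indicator {s<..1} r \<partial>lborel) + (\<integral>\<^sup>+ r. f r * indicator {1<..s + 1} r \<partial>lborel)"
    by (intro nn_integral_add) auto
  also have "(\<integral>\<^sup>+ r. f r * indicator {1<..s + 1} r \<partial>lborel) = (\<integral>\<^sup>+ r. f r * indicator {0<..s} r \<partial>lborel)"
    by (subst nn_integral_real_affine[where c = 1 and t = 1])
      (auto simp: indicator_def per add.commute intro!: nn_integral_cong)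
  also have "(\<integral>\<^sup>+ r. f r * indicator {s<..1} r \<partial>lborel) + (\<integral>\<^sup>+ r. f r * indicator {0<..s} r \<partial>lborel)
      = (\<integral>\<^sup>+ r. f r * indicator {s<..1} r + f r * indicator {0<..s} r \<partial>lborel)"
    by (intro nn_integral_add [symmetric]) auto
  also have "\<dots> = (\<integral>\<^sup>+ t. f t \<partial>unit_ivl)"
    using AE_lborel_singleton[of 0] s
    by (auto simp: nn_integral_restrict_space indicator_def intro!: nn_integral_cong_AE elim!: eventually_mono)
  finally show ?thesis .
qed

text \<open>The zero set is closed, so it contains an open interval as soon as it contains almost
  all of it; closure and periodicity do the rest. This upgrades the equality case from almost all
  parameters to all.\<close>

lemma AE_unit_ivl_continuous:
  fixes f :: "real \<Rightarrow> 'a::real_normed_vector"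
  assumes cont: "continuous_on UNIV f" and per: "\<And>x. f (x + 1) = f x"
    and ae: "AE t in unit_ivl. f t = 0"
  shows "f x = 0"
proof -
  have cl: "closed {t. f t = 0}"
    by (intro closed_Collect_eq cont continuous_on_const)
  have "AE t in lborel. t \<in> {0..1} \<longrightarrow> f t = 0"
    using ae by (subst (asm) AE_restrict_space_iff) auto
  then have "AE t \<in> {0<..<1} in lebesgue. t \<in> {t. f t = 0}"
    by (intro AE_completion) (auto elim!: eventually_mono)
  then have i: "{0<..<1} \<subseteq> {t. f t = 0}"
    by (intro subsetI mem_closed_if_AE_lebesgue_open[OF open_greaterThanLessThan cl])
  have "closure {0<..<1} \<subseteq> {t. f t = 0}" by (rule closure_minimal[OF i cl])
  then have "f (x + of_int (- \<lfloor>x\<rfloor>)) = 0"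
    by (intro subsetD[of "{0..1}" "{t. f t = 0}", simplified]) (auto, linarith+)
  then show ?thesis by (simp only: periodic_add_of_int[of f, OF per])
qed

text \<open>The difference f - g has integral zero; finiteness of the integral of g is what permits
  subtracting in \<open>ennreal\<close>.\<close>

lemma AE_eq_of_nn_integral_le:
  assumes [measurable]: "f \<in> borel_measurable M" "g \<in> borel_measurable M"
    and le: "AE x in M. g x \<le> f x" and int: "integral\<^sup>N M f \<le> integral\<^sup>N M g" "integral\<^sup>N M g < \<infinity>"
  shows "AE x in M. f x = g x"
proof -
  have "(\<integral>\<^sup>+ x. f x - g x \<partial>M) = integral\<^sup>N M f - integral\<^sup>N M g"
    using int le by (intro nn_integral_diff) auto
  also have "\<dots> = 0" using int by (intro diff_eq_0_ennreal) auto
  finally have "AE x in M. f x - g x = 0" by (subst (asm) nn_integral_0_iff_AE) auto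
  then show ?thesis using le by eventually_elim (auto simp: diff_eq_0_iff_ennreal)
qed

text \<open>With u = x^2 / c^2 the claim is 1 + \<sigma>/2 <= u^(-\<sigma>/2) + (\<sigma>/2) u. It
  combines e^z >= 1 + z with ln u <= u - 1, and equality in the latter forces u = 1. The quadratic
  term stands on the right so that all terms are nonnegative.\<close>

lemma powr_tangent:
  fixes x c \<sigma> :: real
  assumes "0 < x" "0 < c" "0 < \<sigma>"
  shows "1 / c powr \<sigma> * (1 + \<sigma> / 2) \<le> 1 / x powr \<sigma> + 1 / c powr \<sigma> * (\<sigma> / 2) * (x\<^sup>2 / c\<^sup>2)"
    and "1 / c powr \<sigma> * (1 + \<sigma> / 2) = 1 / x powr \<sigma> + 1 / c powr \<sigma> * (\<sigma> / 2) * (x\<^sup>2 / c\<^sup>2) \<Longrightarrow> x = c"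
proof -
  define u where "u = x\<^sup>2 / c\<^sup>2"
  have u: "0 < u" using assms by (simp add: u_def)
  have lnu: "ln u = 2 * (ln x - ln c)"
    using assms by (simp add: u_def ln_div ln_realpow)
  have e: "1 / x powr \<sigma> = 1 / c powr \<sigma> * exp (- (\<sigma> / 2) * ln u)"
    using assms by (simp add: lnu powr_def exp_minus exp_diff field_simps flip: exp_add)
  have le1: "1 - \<sigma> / 2 * ln u \<le> exp (- (\<sigma> / 2) * ln u)"
    using exp_ge_add_one_self[of "- (\<sigma> / 2) * ln u"] by simp
  have le2: "\<sigma> / 2 * ln u \<le> \<sigma> / 2 * (u - 1)"
    using ln_le_minus_one[OF u] assms by (intro mult_left_mono) auto
  have le: "1 + \<sigma> / 2 \<le> exp (- (\<sigma> / 2) * ln u) + \<sigma> / 2 * u"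
    using le1 le2 by (simp add: algebra_simps)
  have c0: "0 < 1 / c powr \<sigma>" using assms by simp
  have fac: "1 / x powr \<sigma> + 1 / c powr \<sigma> * (\<sigma> / 2) * (x\<^sup>2 / c\<^sup>2)
    = 1 / c powr \<sigma> * (exp (- (\<sigma> / 2) * ln u) + \<sigma> / 2 * u)"
    unfolding e by (simp add: u_def algebra_simps)
  show "1 / c powr \<sigma> * (1 + \<sigma> / 2) \<le> 1 / x powr \<sigma> + 1 / c powr \<sigma> * (\<sigma> / 2) * (x\<^sup>2 / c\<^sup>2)"
    unfolding fac using le c0 by (intro mult_left_mono) auto
  assume "1 / c powr \<sigma> * (1 + \<sigma> / 2) = 1 / x powr \<sigma> + 1 / c powr \<sigma> * (\<sigma> / 2) * (x\<^sup>2 / c\<^sup>2)"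
  then have "1 + \<sigma> / 2 = exp (- (\<sigma> / 2) * ln u) + \<sigma> / 2 * u"
    unfolding fac using c0 by (subst (asm) mult_left_cancel) auto
  then have "\<sigma> / 2 * ln u = \<sigma> / 2 * (u - 1)"
    using le1 le2 by (simp add: algebra_simps)
  then have "ln u = u - 1" using assms by simp
  then have "u = 1" using u by (intro ln_eq_minus_one)
  then have "x\<^sup>2 = c\<^sup>2" using assms by (simp add: u_def)
  then show "x = c" using assms by (simp add: power2_eq_iff_nonneg)
qed


section \<open>Uniqueness of weak derivatives and rigidity of the circle\<close>

lemma test_functionsD:
  assumes "\<phi> \<in> test_functions"
  shows "(\<phi> has_field_derivative deriv \<phi> t) (at t)" "continuous_on A (deriv \<phi>)"
    "continuous_on A \<phi>" "\<phi> 0 = 0" "\<phi> 1 = 0"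
proof -
  obtain D where D: "\<And>t. (\<phi> has_vector_derivative D t) (at t)" "continuous_on UNIV D"
    using assms unfolding test_functions_def C1_differentiable_on_def by blast
  then have D': "(\<phi> has_field_derivative D t) (at t)" for t
    by (simp add: has_real_derivative_iff_has_vector_derivative)
  then have eq: "deriv \<phi> = D" using DERIV_imp_deriv by blast
  show d: "(\<phi> has_field_derivative deriv \<phi> t) (at t)" for t using D' eq by simp
  show "continuous_on A (deriv \<phi>)" using D(2) eq continuous_on_subset by blast
  show "continuous_on A \<phi>" using d by (meson DERIV_isCont continuous_at_imp_continuous_on)
  have "closure {t. \<phi> t \<noteq> 0} \<subseteq> {0<..<1}" using assms unfolding test_functions_def by blast
  then have "{t. \<phi> t \<noteq> 0} \<subseteq> {0<..<1}" by (rule subset_trans[OF closure_subset])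
  then show "\<phi> 0 = 0" "\<phi> 1 = 0" by auto
qed

text \<open>Integration by parts; the boundary terms vanish because test functions are zero at 0 and
  1.\<close>

lemma has_weak_deriv_of_derivative:
  fixes y y' :: "real \<Rightarrow> 'a::euclidean_space"
  assumes der: "\<And>t. (y has_vector_derivative y' t) (at t)" and cont': "continuous_on UNIV y'"
  shows "has_weak_deriv y y'"
  unfolding has_weak_deriv_def
proof
  fix \<phi> :: "real \<Rightarrow> real" assume "\<phi> \<in> test_functions"
  note \<phi> = test_functionsD[OF this]
  have cont: "continuous_on A y" for A
    using der by (meson continuous_at_imp_continuous_on has_vector_derivative_continuous)
  have c: "continuous_on {0..1} (\<lambda>t. deriv \<phi> t *\<^sub>R y t)" "continuous_on {0..1} (\<lambda>t. \<phi> t *\<^sub>R y' t)"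
    by (intro continuous_intros \<phi> cont continuous_on_subset[OF cont'] subset_UNIV)+
  have "((\<lambda>t. \<phi> t *\<^sub>R y' t + deriv \<phi> t *\<^sub>R y t) has_integral (\<phi> 1 *\<^sub>R y 1 - \<phi> 0 *\<^sub>R y 0)) {0..1}"
  proof (rule fundamental_theorem_of_calculus)
    show "((\<lambda>t. \<phi> t *\<^sub>R y t) has_vector_derivative \<phi> t *\<^sub>R y' t + deriv \<phi> t *\<^sub>R y t) (at t within {0..1})" for t
      by (intro has_vector_derivative_scaleR has_field_derivative_at_within[OF \<phi>(1)]
          has_vector_derivative_at_within[OF der])
  qed simp
  then have "integral {0..1} (\<lambda>t. \<phi> t *\<^sub>R y' t + deriv \<phi> t *\<^sub>R y t) = 0"
    by (simp add: \<phi> integral_unique)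
  then have "integral {0..1} (\<lambda>t. deriv \<phi> t *\<^sub>R y t) = - integral {0..1} (\<lambda>t. \<phi> t *\<^sub>R y' t)"
    using c by (simp add: Henstock_Kurzweil_Integration.integral_add integrable_continuous_interval eq_neg_iff_add_eq_0 add.commute)
  then show "(LINT t|lebesgue_on {0..1}. deriv \<phi> t *\<^sub>R y t) = - (LINT t|lebesgue_on {0..1}. \<phi> t *\<^sub>R y' t)"
    using c by (simp add: lebesgue_integral_eq_integral continuous_imp_integrable_real)
qed

text \<open>The positive and negative parts of f, read as densities, give measures that agree on all
  open half lines and hence coincide. The two parts are then equal almost everywhere, and they are
  never both positive.\<close>

lemma AE_eq_0_of_integral_greaterThan:
  fixes f :: "real \<Rightarrow> real"
  assumes int: "integrable lborel f" and 0: "\<And>x. (LINT t|lborel. indicator {x<..} t * f t) = 0"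
  shows "AE t in lborel. f t = 0"
proof -
  have [measurable]: "f \<in> borel_measurable borel" using int by (auto dest: borel_measurable_integrable)
  have eq: "(\<integral>\<^sup>+ t. ennreal (f t) * indicator {x<..} t \<partial>lborel) = (\<integral>\<^sup>+ t. ennreal (- f t) * indicator {x<..} t \<partial>lborel)"
    and fin: "(\<integral>\<^sup>+ t. ennreal (f t) * indicator {x<..} t \<partial>lborel) < \<infinity>" for x
  proof -
    define h where "h t = indicator {x<..} t * f t" for t
    have h: "integrable lborel h"
      unfolding h_def using integrable_mult_indicator[of "{x<..}" lborel f] int by simp
    have e: "(\<integral>\<^sup>+ t. ennreal (f t) * indicator {x<..} t \<partial>lborel) = (\<integral>\<^sup>+ t. ennreal (h t) \<partial>lborel)"
      "(\<integral>\<^sup>+ t. ennreal (- f t) * indicator {x<..} t \<partial>lborel) = (\<integral>\<^sup>+ t. ennreal (- h t) \<partial>lborel)"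
      by (auto simp: h_def indicator_def intro!: nn_integral_cong)
    have f1: "(\<integral>\<^sup>+ t. ennreal (h t) \<partial>lborel) < \<infinity>" "(\<integral>\<^sup>+ t. ennreal (- h t) \<partial>lborel) < \<infinity>"
      using h by (auto simp: real_integrable_def top.not_eq_extremum)
    have "enn2real (\<integral>\<^sup>+ t. ennreal (h t) \<partial>lborel) = enn2real (\<integral>\<^sup>+ t. ennreal (- h t) \<partial>lborel)"
    proof -
      have "integral\<^sup>L lborel h = 0" using 0[of x] by (simp add: h_def [abs_def])
      then show ?thesis using real_lebesgue_integral_def[OF h] by linarith
    qed
    then have "(\<integral>\<^sup>+ t. ennreal (h t) \<partial>lborel) = (\<integral>\<^sup>+ t. ennreal (- h t) \<partial>lborel)"
      using f1 by (metis ennreal_enn2real infinity_ennreal_def)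
    then show "(\<integral>\<^sup>+ t. ennreal (f t) * indicator {x<..} t \<partial>lborel) = (\<integral>\<^sup>+ t. ennreal (- f t) * indicator {x<..} t \<partial>lborel)"
      "(\<integral>\<^sup>+ t. ennreal (f t) * indicator {x<..} t \<partial>lborel) < \<infinity>"
      using e f1 by auto
  qed
  \<comment> \<open>\<open>ennreal\<close> sends negative reals to 0, so these densities are the
    positive and the negative part.\<close>
  have "density lborel (\<lambda>t. ennreal (f t)) = density lborel (\<lambda>t. ennreal (- f t))"
    by (rule measure_eqI_lessThan) (use eq fin in \<open>auto simp: emeasure_density\<close>)
  then have "AE t in lborel. ennreal (f t) = ennreal (- f t)"
    by (subst (asm) sigma_finite_measure.density_unique_iff[OF sigma_finite_lborel]) auto
  then show ?thesis
  proof eventually_elim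
    case (elim t)
    then show ?case
      by (cases "0 \<le> f t") (auto simp: ennreal_neg ennreal_eq_0_iff dest!: sym[of 0])
  qed
qed

lemma AE_eq_0_of_interval_integrals:
  fixes f :: "real \<Rightarrow> 'a::euclidean_space"
  assumes int: "f absolutely_integrable_on {0..1}"
    and 0: "\<And>a. 0 \<le> a \<Longrightarrow> a \<le> 1 \<Longrightarrow> integral {a..1} f = 0"
  shows "AE t in lebesgue_on {0..1}. f t = 0"
proof -
  have comp: "AE t in lebesgue. indicator {0..1} t * (f t \<bullet> i) = 0" if i: "i \<in> Basis" for i
  proof -
    define F where "F t = indicator {0..1} t * (f t \<bullet> i)" for t :: real
    have Fi: "integrable lebesgue F"
      using absolutely_integrable_component[OF int, of i] by (simp add: F_def [abs_def] set_integrable_def)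
    then have Fm: "F \<in> borel_measurable lebesgue" by auto
    have im: "indicat_real A \<in> borel_measurable lebesgue" if "A \<in> sets borel" for A :: "real set"
      using that by (intro borel_measurable_indicator) auto
    \<comment> \<open>\<open>F\<close> is merely Lebesgue measurable, while the comparison of
      densities is made for Borel functions.\<close>
    obtain h :: "real \<Rightarrow> real" where h [measurable]: "h \<in> borel_measurable lborel" and Fh: "AE t in lborel. F t = h t"
      using completion_ex_borel_measurable_real[OF Fm] by blast
    have Fh': "AE t in lebesgue. F t = h t" using Fh by (rule AE_completion)
    have "integrable lebesgue h"
      using Fi Fh' Fm measurable_completion[OF h] by (subst integrable_cong_AE[symmetric]) auto
    then have hi: "integrable lborel h" using integrable_completion[OF h] by simp
    have "AE t in lborel. h t = 0"
    proof (rule AE_eq_0_of_integral_greaterThan[OF hi])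
      fix x :: real
      \<comment> \<open>The projection of \<open>x\<close> to [0,1]: as \<open>F\<close> vanishes
        outside [0,1], integrating it over {x<..} or over [a,1] differs at most by the point
        a.\<close>
      define a where "a = max 0 (min 1 x)"
      have a: "0 \<le> a" "a \<le> 1" by (auto simp: a_def)
      have "(LINT t|lborel. indicator {x<..} t * h t) = (LINT t|lebesgue. indicator {x<..} t * h t)"
        by (intro integral_completion [symmetric]) measurable
      also have "\<dots> = (LINT t|lebesgue. indicator {x<..} t * F t)"
        using Fh' by (intro integral_cong_AE borel_measurable_times im Fm measurable_completion[OF h])
          (auto elim!: eventually_mono)
      also have "\<dots> = (LINT t|lebesgue. indicator {a..1} t * (f t \<bullet> i))"
      proof (rule integral_cong_AE)
        have "AE t in lebesgue. t \<noteq> a" by (rule AE_completion[OF AE_lborel_singleton])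
        then show "AE t in lebesgue. indicator {x<..} t * F t = indicator {a..1} t * (f t \<bullet> i)"
          by eventually_elim (auto simp: F_def a_def indicator_def)
      next
        have "(\<lambda>t. indicator {a..1} t * F t) \<in> borel_measurable lebesgue"
          by (intro borel_measurable_times im Fm) auto
        moreover have "(\<lambda>t. indicator {a..1} t * F t) = (\<lambda>t. indicator {a..1} t * (f t \<bullet> i))"
          using a by (auto simp: F_def indicator_def)
        ultimately show "(\<lambda>t. indicator {a..1} t * (f t \<bullet> i)) \<in> borel_measurable lebesgue" by simp
      qed (intro borel_measurable_times im Fm, auto)
      also have "\<dots> = (LINT t:{a..1}|lebesgue. f t \<bullet> i)" by (simp add: set_lebesgue_integral_def)
      also have "\<dots> = integral {a..1} (\<lambda>t. f t \<bullet> i)"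
      proof (rule set_lebesgue_integral_eq_integral(2))
        show "(\<lambda>t. f t \<bullet> i) absolutely_integrable_on {a..1}"
          by (rule set_integrable_subset[OF absolutely_integrable_component[OF int]]) (use a in auto)
      qed
      also have "\<dots> = integral {a..1} f \<bullet> i"
      proof (rule integral_component_eq)
        show "f integrable_on {a..1}"
          by (rule integrable_on_subinterval[OF set_lebesgue_integral_eq_integral(1)[OF int]]) (use a in auto)
      qed
      finally show "(LINT t|lborel. indicator {x<..} t * h t) = 0" using 0[OF a] by simp
    qed
    then have "AE t in lborel. F t = 0" using Fh by eventually_elim simp
    then show ?thesis unfolding F_def by (rule AE_completion)
  qed
  have "AE t in lebesgue. \<forall>i\<in>Basis. indicator {0..1} t * (f t \<bullet> i) = 0"
    by (intro AE_finite_allI comp) auto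
  then have "AE t in lebesgue. t \<in> {0..1} \<longrightarrow> f t = 0"
    by eventually_elim (auto simp: euclidean_all_zero_iff)
  then show ?thesis by (subst AE_restrict_space_iff) auto
qed

text \<open>Both functions have the increments of y as their interval integrals. As
  \<open>weak_deriv\<close> is an arbitrary choice, this is what allows the energy of an explicit
  curve to be computed from its classical derivative.\<close>

lemma weak_deriv_AE_eq:
  fixes y g h :: "real \<Rightarrow> 'a::euclidean_space"
  assumes cont: "continuous_on {0..1} y"
    and g: "g \<in> L2_01" "has_weak_deriv y g" and h: "h \<in> L2_01" "has_weak_deriv y h"
  shows "AE t in lebesgue_on {0..1}. g t = h t"
proof -
  note ig = integrable_on_L2_01(1)[OF g(1)] and ih = integrable_on_L2_01(1)[OF h(1)]
  have "AE t in lebesgue_on {0..1}. g t - h t = 0"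
  proof (rule AE_eq_0_of_interval_integrals)
    show "(\<lambda>t. g t - h t) absolutely_integrable_on {0..1}"
      using ig ih by (rule set_integral_diff(1))
    fix a :: real assume a: "0 \<le> a" "a \<le> 1"
    have "g integrable_on {a..1}" "h integrable_on {a..1}"
      using set_lebesgue_integral_eq_integral(1)[OF ig] set_lebesgue_integral_eq_integral(1)[OF ih] a
      by (auto intro: integrable_on_subinterval)
    then show "integral {a..1} (\<lambda>t. g t - h t) = 0"
      using weak_deriv_increment[OF cont g a] weak_deriv_increment[OF cont h a]
      by (simp add: Henstock_Kurzweil_Integration.integral_diff)
  qed
  then show ?thesis by eventually_elim simp
qed

lemma continuous_imp_L2_01:
  fixes g :: "real \<Rightarrow> 'a::euclidean_space"
  assumes "continuous_on {0..1} g" shows "g \<in> L2_01"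
proof -
  have "integrable (lebesgue_on {0..1}) g" "integrable (lebesgue_on {0..1}) (\<lambda>t. (norm (g t))\<^sup>2)"
    by (intro continuous_imp_integrable_real continuous_intros assms)+
  then show ?thesis by (auto simp: L2_01_def)
qed

text \<open>Averaging the squared chord lengths over one end point, and then over both, shows that the
  curve lies on the unit sphere; the inner products are then determined by the chords.\<close>

lemma circle_of_chords:
  fixes y :: "real \<Rightarrow> 'a::euclidean_space"
  assumes cont: "continuous_on UNIV y" and per: "\<And>x. y (x + 1) = y x" and mean: "integral {0..1} y = 0"
    and ch: "\<And>s t. (norm (y (s + t) - y s))\<^sup>2 = 2 - 2 * cos (2 * pi * t)"
  shows "norm (y 0) = 1" "norm (y (1/4)) = 1" "y 0 \<bullet> y (1/4) = 0"
    "y t = cos (2 * pi * t) *\<^sub>R y 0 + sin (2 * pi * t) *\<^sub>R y (1/4)"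
proof -
  have ch': "(norm (y b - y a))\<^sup>2 = 2 - 2 * cos (2 * pi * (b - a))" for a b
    using ch[of a "b - a"] by simp
  have int: "f integrable_on {0..1::real}" if "continuous_on UNIV f" for f :: "real \<Rightarrow> 'b::euclidean_space"
    by (intro integrable_continuous_interval continuous_on_subset[OF that]) auto
  have n2: "(norm (y a))\<^sup>2 = 2 - integral {0..1} (\<lambda>b. (norm (y b))\<^sup>2)" for a
  proof -
    have "((\<lambda>b. cos (2 * pi * (b - a))) has_integral
        (sin (2 * pi * (1 - a)) / (2 * pi) - sin (2 * pi * (0 - a)) / (2 * pi))) {0..1}"
      by (intro fundamental_theorem_of_calculus)
        (auto intro!: derivative_eq_intros simp flip: has_real_derivative_iff_has_vector_derivative)
    moreover have "sin (2 * pi * (1 - a)) = sin (2 * pi * (0 - a))"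
      using sin_periodic[of "- (2 * pi * a)"] by (simp add: algebra_simps)
    ultimately have c0: "((\<lambda>b. cos (2 * pi * (b - a))) has_integral 0) {0..1}" by simp
    have m: "((\<lambda>b. y b \<bullet> y a) has_integral 0) {0..1}"
      using has_integral_linear[OF integrable_integral[OF int[OF cont]] bounded_linear_inner_left[of "y a"]]
      by (simp add: o_def mean)
    have Y: "((\<lambda>b. (norm (y b))\<^sup>2) has_integral integral {0..1} (\<lambda>b. (norm (y b))\<^sup>2)) {0..1}"
      by (intro integrable_integral int continuous_intros cont)
    have C: "((\<lambda>b::real. c) has_integral c) {0..1}" for c :: real
      using has_integral_const_real[of c 0 1] by simp
    have eq: "(norm (y a))\<^sup>2 = 2 - 2 * cos (2 * pi * (b - a)) + 2 * (y b \<bullet> y a) - (norm (y b))\<^sup>2" for b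
      using ch'[of b a] unfolding power2_norm_eq_inner by (simp add: inner_commute algebra_simps)
    have "((\<lambda>b. 2 - 2 * cos (2 * pi * (b - a)) + 2 * (y b \<bullet> y a) - (norm (y b))\<^sup>2) has_integral
        (2 - 2 * 0 + 2 * 0 - integral {0..1} (\<lambda>b. (norm (y b))\<^sup>2))) {0..1}"
      by (rule has_integral_diff has_integral_add has_integral_mult_right C c0 m Y)+
    then have "((\<lambda>b::real. (norm (y a))\<^sup>2) has_integral (2 - 2 * 0 + 2 * 0 - integral {0..1} (\<lambda>b. (norm (y b))\<^sup>2))) {0..1}"
      by (rule has_integral_eq[rotated]) (rule eq[symmetric])
    from has_integral_unique[OF C this] show ?thesis by simp
  qed
  define Y where "Y = integral {0..1} (\<lambda>b. (norm (y b))\<^sup>2)"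
  have "Y = integral {0..1} (\<lambda>b::real. 2 - Y)"
    unfolding Y_def by (rule Henstock_Kurzweil_Integration.integral_cong) (rule n2)
  then have "Y = 1" by simp
  then have n1: "y a \<bullet> y a = 1" for a using n2[of a] by (simp add: Y_def power2_norm_eq_inner)
  then show "norm (y 0) = 1" "norm (y (1/4)) = 1" by (simp_all add: norm_eq_1)
  have ip: "y b \<bullet> y a = cos (2 * pi * (b - a))" for a b
    using ch'[of b a] n1[of a] n1[of b] unfolding power2_norm_eq_inner by (simp add: inner_commute algebra_simps)
  have c90: "cos (pi / 2 - x) = sin x" "cos (x - pi / 2) = sin x" for x :: real
    by (simp_all add: cos_diff)
  have ip2: "y t \<bullet> y (1/4) = sin (2 * pi * t)" for t
    using ip[of t "1/4"] c90(2)[of "2 * pi * t"] by (simp add: right_diff_distrib)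
  show o: "y 0 \<bullet> y (1/4) = 0" using ip2[of 0] by simp
  \<comment> \<open>The residual of \<open>y t\<close> after projection to the orthonormal pair
    \<open>y 0\<close>, \<open>y (1/4)\<close>. The unit vector \<open>y t\<close> has components
    cos and sin there, whose squares already sum to 1, so nothing is left.\<close>
  define z where "z = y t - (cos (2 * pi * t) *\<^sub>R y 0 + sin (2 * pi * t) *\<^sub>R y (1/4))"
  have "z \<bullet> z = 1 + (cos (2 * pi * t))\<^sup>2 + (sin (2 * pi * t))\<^sup>2
     - 2 * cos (2 * pi * t) * (y t \<bullet> y 0) - 2 * sin (2 * pi * t) * (y t \<bullet> y (1/4))"
    unfolding z_def using n1 o
    by (simp add: inner_diff inner_add inner_commute power2_eq_square algebra_simps)
  also have "\<dots> = 1 - ((sin (2 * pi * t))\<^sup>2 + (cos (2 * pi * t))\<^sup>2)"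
    using ip[of t 0] ip2[of t] by (simp add: power2_eq_square)
  also have "\<dots> = 0" by simp
  finally have "z = 0" by simp
  then show "y t = cos (2 * pi * t) *\<^sub>R y 0 + sin (2 * pi * t) *\<^sub>R y (1/4)" by (simp add: z_def)
qed


section \<open>The minimum of the action\<close>

definition energy :: "(real \<Rightarrow> 'a::euclidean_space) \<Rightarrow> real" where
  "energy y = integral {0..1} (\<lambda>s. (norm (weak_deriv y s))\<^sup>2)"

lemma nn_integral_energy:
  fixes y :: "real \<Rightarrow> 'a::euclidean_space"
  assumes y: "y \<in> H1_01" and c: "0 \<le> c"
  shows "(\<integral>\<^sup>+ s. ennreal (c * (norm (weak_deriv y s))\<^sup>2) \<partial>lebesgue_on {0..1}) = ennreal (c * energy y)"
proof -
  have int: "integrable (lebesgue_on {0..1}) (\<lambda>s. (norm (weak_deriv y s))\<^sup>2)"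
    using weak_deriv_spec(1)[OF y] by (simp add: L2_01_def)
  then show ?thesis
    using c nn_integral_eq_integral[of "lebesgue_on {0..1}" "\<lambda>s. c * (norm (weak_deriv y s))\<^sup>2"]
    by (simp add: energy_def lebesgue_integral_eq_integral)
qed

lemma energy_nonneg:
  assumes "y \<in> H1_01" shows "0 \<le> energy y"
  unfolding energy_def
  using integrable_on_L2_01(2)[OF weak_deriv_spec(1)[OF assms]] set_lebesgue_integral_eq_integral(1)
  by (intro Henstock_Kurzweil_Integration.integral_nonneg) auto

abbreviation "pair_kernel \<sigma> y s t \<equiv> 1 / ennreal (norm (y s - y (s + t)) powr \<sigma>)"

definition pair_potential :: "real \<Rightarrow> (real \<Rightarrow> 'a::euclidean_space) \<Rightarrow> real \<Rightarrow> ennreal" where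
  "pair_potential \<sigma> y t = (\<integral>\<^sup>+ s. pair_kernel \<sigma> y s t \<partial>unit_ivl)"

text \<open>The mean over s of the quadratic part of the tangent, with its sign reversed so that it
  is nonnegative and can be added to the potential.\<close>

definition tangent_term :: "real \<Rightarrow> (real \<Rightarrow> 'a::euclidean_space) \<Rightarrow> real \<Rightarrow> real" where
  "tangent_term \<sigma> y t = circle_kernel \<sigma> t * (\<sigma> / 2) * (chord y t / (2 * sin (pi * t))\<^sup>2)"

text \<open>For fixed s the substitution r = s + t preserves the integral over a period. Swapping
  the integrals then puts t outside, so that the tangent point 2 sin(pi t) is constant in the inner
  integral.\<close>

lemma potential_shift:
  fixes y :: "real \<Rightarrow> 'a::euclidean_space"
  assumes cont: "continuous_on UNIV y" and per: "\<And>x. y (x + 1) = y x"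
  shows "(\<integral>\<^sup>+ s. (\<integral>\<^sup>+ r. 1 / ennreal (norm (y s - y r) powr \<sigma>) \<partial>lebesgue_on {0..1}) \<partial>lebesgue_on {0..1})
    = (\<integral>\<^sup>+ t. (\<integral>\<^sup>+ s. pair_kernel \<sigma> y s t \<partial>unit_ivl) \<partial>unit_ivl)"
proof -
  have [measurable]: "y \<in> borel_measurable borel"
    using cont by (rule borel_measurable_continuous_onI)
  have [measurable]: "fst \<in> borel_measurable (unit_ivl \<Otimes>\<^sub>M unit_ivl)" "snd \<in> borel_measurable (unit_ivl \<Otimes>\<^sub>M unit_ivl)"
    by (rule measurable_compose[OF measurable_fst] measurable_compose[OF measurable_snd], rule measurable_unit_ivl, simp)+
  have "(\<integral>\<^sup>+ s. (\<integral>\<^sup>+ r. 1 / ennreal (norm (y s - y r) powr \<sigma>) \<partial>unit_ivl) \<partial>unit_ivl)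
    = (\<integral>\<^sup>+ s. (\<integral>\<^sup>+ t. pair_kernel \<sigma> y s t \<partial>unit_ivl) \<partial>unit_ivl)"
  proof (rule nn_integral_cong)
    fix s assume "s \<in> space unit_ivl"
    then have s: "0 \<le> s" "s \<le> 1" by (auto simp: space_restrict_space)
    show "(\<integral>\<^sup>+ r. 1 / ennreal (norm (y s - y r) powr \<sigma>) \<partial>unit_ivl) = (\<integral>\<^sup>+ t. pair_kernel \<sigma> y s t \<partial>unit_ivl)"
      by (rule nn_integral_periodic_shift[symmetric]) (use s in \<open>auto simp: per\<close>)
  qed
  also have "\<dots> = (\<integral>\<^sup>+ t. (\<integral>\<^sup>+ s. pair_kernel \<sigma> y s t \<partial>unit_ivl) \<partial>unit_ivl)"
    by (rule unit_ivl2.Fubini'[symmetric]) (simp add: split_beta')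
  finally show ?thesis by (simp add: nn_integral_lebesgue_on_unit)
qed

lemma action_eq:
  fixes y :: "real \<Rightarrow> 'a::euclidean_space"
  assumes y: "y \<in> Lambda"
  shows "action v \<sigma> y = ennreal (v\<^sup>2 / 2 * energy y)
    + 1 / 2 * (\<integral>\<^sup>+ t. (\<integral>\<^sup>+ s. pair_kernel \<sigma> y s t \<partial>unit_ivl) \<partial>unit_ivl)"
  unfolding action_def potential_shift[OF LambdaD(3,1)[OF y]]
  by (subst nn_integral_energy[OF LambdaD(2)[OF y]]) simp_all

lemma AE_unit_ivl_interior: "AE t in unit_ivl. 0 < t \<and> t < 1"
proof -
  have "AE t in lborel. t \<noteq> 0 \<and> t \<noteq> (1::real)"
    using AE_lborel_singleton[of 0] AE_lborel_singleton[of 1] by eventually_elim simp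
  then have "AE t in lborel. t \<in> {0..1} \<longrightarrow> 0 < t \<and> t < (1::real)"
    by (rule eventually_mono) auto
  then show ?thesis by (subst AE_restrict_space_iff) auto
qed

lemma pair_kernel_tangent:
  fixes y :: "real \<Rightarrow> 'a::euclidean_space" and \<sigma> s t :: real
  assumes \<sigma>: "0 < \<sigma>" and t: "0 < t" "t < 1"
  defines "q \<equiv> circle_kernel \<sigma> t * (\<sigma> / 2) * ((norm (y (s + t) - y s))\<^sup>2 / (2 * sin (pi * t))\<^sup>2)"
  shows "ennreal (circle_kernel \<sigma> t * (1 + \<sigma> / 2)) \<le> pair_kernel \<sigma> y s t + ennreal q"
    and "pair_kernel \<sigma> y s t + ennreal q = ennreal (circle_kernel \<sigma> t * (1 + \<sigma> / 2)) \<Longrightarrow>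
      norm (y (s + t) - y s) = 2 * sin (pi * t)"
proof -
  define c where "c = 2 * sin (pi * t)"
  have c: "0 < c" using t by (auto simp: c_def intro!: sin_gt_zero)
  have K: "circle_kernel \<sigma> t = 1 / c powr \<sigma>" by (simp add: circle_kernel_def c_def)
  define x where "x = norm (y (s + t) - y s)"
  have x: "norm (y s - y (s + t)) = x" by (simp add: x_def norm_minus_commute)
  have q0: "0 \<le> q" using \<sigma> by (simp add: q_def circle_kernel_nonneg)
  have "ennreal (circle_kernel \<sigma> t * (1 + \<sigma> / 2)) \<le> pair_kernel \<sigma> y s t + ennreal q \<and>
    (pair_kernel \<sigma> y s t + ennreal q = ennreal (circle_kernel \<sigma> t * (1 + \<sigma> / 2)) \<longrightarrow> x = c)"
  proof (cases "x = 0")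
    \<comment> \<open>At a collision the kernel is infinite, so the inequality is trivial and
      equality with the finite left-hand side impossible.\<close>
    case True
    then show ?thesis unfolding x by (simp add: ennreal_divide_zero)
  next
    case False
    then have x0: "0 < x" by (simp add: x_def)
    have e: "pair_kernel \<sigma> y s t + ennreal q = ennreal (1 / x powr \<sigma> + q)"
      unfolding x using x0 q0 by (simp add: ennreal_plus divide_ennreal flip: ennreal_1)
    have q: "q = 1 / c powr \<sigma> * (\<sigma> / 2) * (x\<^sup>2 / c\<^sup>2)" by (simp add: q_def K x_def c_def)
    have "0 \<le> 1 / c powr \<sigma> * (1 + \<sigma> / 2)" "0 \<le> 1 / x powr \<sigma> + q" using \<sigma> q0 by auto
    then show ?thesis
      unfolding e K using powr_tangent[OF x0 c \<sigma>, folded q] by (auto simp: ennreal_le_iff)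
  qed
  then show "ennreal (circle_kernel \<sigma> t * (1 + \<sigma> / 2)) \<le> pair_kernel \<sigma> y s t + ennreal q"
    and "pair_kernel \<sigma> y s t + ennreal q = ennreal (circle_kernel \<sigma> t * (1 + \<sigma> / 2)) \<Longrightarrow>
      norm (y (s + t) - y s) = 2 * sin (pi * t)"
    by (auto simp: x_def c_def)
qed

section \<open>The lower bound, its equality case and the value on circles\<close>

locale circle_problem =
  fixes \<sigma> v :: real
  assumes \<sigma>: "0 < \<sigma>" "\<sigma> < 1"
    and v: "v\<^sup>2 = \<sigma> / (8 * pi\<^sup>2) * (LINT t|lebesgue_on {0..1}. circle_kernel \<sigma> t)"
begin

definition mass :: real where "mass = (LINT t|lebesgue_on {0..1}. circle_kernel \<sigma> t)"

lemma mass_nonneg: "0 \<le> mass"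
  unfolding mass_def by (intro integral_nonneg_AE AE_I2 circle_kernel_nonneg)

lemma nn_integral_kernel_mult:
  assumes "0 \<le> c"
  shows "(\<integral>\<^sup>+ t. ennreal (circle_kernel \<sigma> t * c) \<partial>unit_ivl) = ennreal (mass * c)"
proof -
  have "(\<integral>\<^sup>+ t. ennreal (circle_kernel \<sigma> t * c) \<partial>unit_ivl) = (\<integral>\<^sup>+ t. ennreal (circle_kernel \<sigma> t) * ennreal c \<partial>unit_ivl)"
    using assms by (simp add: ennreal_mult circle_kernel_nonneg)
  also have "\<dots> = (\<integral>\<^sup>+ t. ennreal (circle_kernel \<sigma> t) \<partial>unit_ivl) * ennreal c"
    by (rule nn_integral_multc) measurable
  also have "\<dots> = ennreal (mass * c)"
    using assms mass_nonneg
    by (simp add: nn_integral_unit_ivl_circle_kernel[OF \<sigma>] ennreal_mult flip: mass_def)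
  finally show ?thesis .
qed

context
  fixes y :: "real \<Rightarrow> 'a::euclidean_space"
  assumes y: "y \<in> Lambda"
begin

lemma borel_y [measurable]: "y \<in> borel_measurable borel"
  using LambdaD(3)[OF y] by (rule borel_measurable_continuous_onI)

lemma fst_snd_borel [measurable]:
  "fst \<in> borel_measurable (unit_ivl \<Otimes>\<^sub>M unit_ivl)" "snd \<in> borel_measurable (unit_ivl \<Otimes>\<^sub>M unit_ivl)"
  by (rule measurable_compose[OF measurable_fst] measurable_compose[OF measurable_snd], rule measurable_unit_ivl, simp)+


lemma pair_potential_measurable [measurable]: "pair_potential \<sigma> y \<in> borel_measurable unit_ivl"
  unfolding pair_potential_def by measurable

lemma tangent_term_eq: "(\<integral>\<^sup>+ s. ennreal (circle_kernel \<sigma> t * (\<sigma> / 2) * ((norm (y (s + t) - y s))\<^sup>2 / (2 * sin (pi * t))\<^sup>2)) \<partial>unit_ivl) = ennreal (tangent_term \<sigma> y t)"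
proof -
  let ?k = "circle_kernel \<sigma> t * (\<sigma> / 2) / (2 * sin (pi * t))\<^sup>2"
  have "continuous_on {0..1} (\<lambda>s. ?k * (norm (y (s + t) - y s))\<^sup>2)"
    by (intro continuous_intros continuous_comp_shift[OF LambdaD(3)[OF y]] continuous_on_subset[OF LambdaD(3)[OF y]]) auto
  from nn_integral_unit_ivl_continuous[OF this] show ?thesis
    using \<sigma> by (simp add: tangent_term_def chord_def circle_kernel_nonneg)
qed

lemma tangent_term_measurable [measurable]: "(\<lambda>t. ennreal (tangent_term \<sigma> y t)) \<in> borel_measurable unit_ivl"
  unfolding tangent_term_eq[symmetric] by measurable

lemma pointwise_bound:
  assumes t: "0 < t" "t < 1"
  shows "ennreal (circle_kernel \<sigma> t * (1 + \<sigma> / 2)) \<le> pair_potential \<sigma> y t + ennreal (tangent_term \<sigma> y t)"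
    and "pair_potential \<sigma> y t + ennreal (tangent_term \<sigma> y t) = ennreal (circle_kernel \<sigma> t * (1 + \<sigma> / 2)) \<Longrightarrow>
      AE s in unit_ivl. norm (y (s + t) - y s) = 2 * sin (pi * t)"
proof -
  let ?q = "\<lambda>s. circle_kernel \<sigma> t * (\<sigma> / 2) * ((norm (y (s + t) - y s))\<^sup>2 / (2 * sin (pi * t))\<^sup>2)"
  let ?C = "ennreal (circle_kernel \<sigma> t * (1 + \<sigma> / 2))"
  have int: "(\<integral>\<^sup>+ s. pair_kernel \<sigma> y s t + ennreal (?q s) \<partial>unit_ivl) = pair_potential \<sigma> y t + ennreal (tangent_term \<sigma> y t)"
    unfolding pair_potential_def tangent_term_eq[symmetric] by (intro nn_integral_add) measurable
  have C: "(\<integral>\<^sup>+ s. ?C \<partial>unit_ivl) = ?C" using emeasure_unit_ivl by simp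
  have le: "?C \<le> pair_kernel \<sigma> y s t + ennreal (?q s)" for s
    by (rule pair_kernel_tangent(1)[OF \<sigma>(1) t])
  then have "(\<integral>\<^sup>+ s. ?C \<partial>unit_ivl) \<le> (\<integral>\<^sup>+ s. pair_kernel \<sigma> y s t + ennreal (?q s) \<partial>unit_ivl)"
    by (intro nn_integral_mono)
  then show "?C \<le> pair_potential \<sigma> y t + ennreal (tangent_term \<sigma> y t)" unfolding C int .
  assume eq: "pair_potential \<sigma> y t + ennreal (tangent_term \<sigma> y t) = ?C"
  have "AE s in unit_ivl. pair_kernel \<sigma> y s t + ennreal (?q s) = ?C"
    by (rule AE_eq_of_nn_integral_le) (use le eq int C in auto)
  then show "AE s in unit_ivl. norm (y (s + t) - y s) = 2 * sin (pi * t)"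
    by eventually_elim (rule pair_kernel_tangent(2)[OF \<sigma>(1) t])
qed

text \<open>The prescribed v is used here: the factor sin^2(pi t) of the chord inequality cancels
  against the squared chord of the circle, and the remaining constant (\<sigma>/2) / (4 pi^2) times
  the integral of the kernel is v^2.\<close>

lemma nn_integral_tangent_term_le: "(\<integral>\<^sup>+ t. ennreal (tangent_term \<sigma> y t) \<partial>unit_ivl) \<le> ennreal (v\<^sup>2 * energy y)"
proof -
  have e: "0 \<le> energy y" using energy_nonneg LambdaD(2)[OF y] .
  have "(\<integral>\<^sup>+ t. ennreal (tangent_term \<sigma> y t) \<partial>unit_ivl) \<le> (\<integral>\<^sup>+ t. ennreal (circle_kernel \<sigma> t * (\<sigma> / (8 * pi\<^sup>2) * energy y)) \<partial>unit_ivl)"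
  proof (rule nn_integral_mono_AE)
    show "AE t in unit_ivl. ennreal (tangent_term \<sigma> y t) \<le> ennreal (circle_kernel \<sigma> t * (\<sigma> / (8 * pi\<^sup>2) * energy y))"
      using AE_unit_ivl_interior
    proof eventually_elim
      case (elim t)
      then have s: "0 < sin (pi * t)" by (auto intro!: sin_gt_zero)
      have "chord y t \<le> energy y * (sin (pi * t))\<^sup>2 / pi\<^sup>2"
        using chord_le_energy_sin[OF y, of t] elim by (simp add: energy_def)
      then have "chord y t / (2 * sin (pi * t))\<^sup>2 \<le> energy y / (4 * pi\<^sup>2)"
        using s by (simp add: field_simps power_mult_distrib)
      then have "tangent_term \<sigma> y t \<le> circle_kernel \<sigma> t * (\<sigma> / 2) * (energy y / (4 * pi\<^sup>2))"
        unfolding tangent_term_def using \<sigma> by (intro mult_left_mono) (auto simp: circle_kernel_nonneg)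
      then show ?case by (intro ennreal_leI) (simp add: field_simps)
    qed
  qed
  also have "\<dots> = ennreal (mass * (\<sigma> / (8 * pi\<^sup>2) * energy y))"
    using \<sigma> e by (intro nn_integral_kernel_mult) auto
  also have "mass * (\<sigma> / (8 * pi\<^sup>2) * energy y) = v\<^sup>2 * energy y"
    by (simp add: v mass_def)
  finally show ?thesis .
qed

text \<open>Doubling clears both factors 1/2, and the kinetic term becomes exactly the bound of
  \<open>nn_integral_tangent_term_le\<close>.\<close>

lemma two_action: "2 * action v \<sigma> y = ennreal (v\<^sup>2 * energy y) + integral\<^sup>N unit_ivl (pair_potential \<sigma> y)"
proof -
  have h: "2 * (1 / 2 * a) = (a :: ennreal)" for a
    by (simp add: mult.assoc[symmetric] ennreal_times_divide ennreal_divide_self)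
  have e: "2 * ennreal (v\<^sup>2 / 2 * energy y) = ennreal (v\<^sup>2 * energy y)"
    using energy_nonneg[OF LambdaD(2)[OF y]] ennreal_mult[of 2 "v\<^sup>2 / 2 * energy y"] by simp
  show ?thesis unfolding action_eq[OF y] distrib_left h e pair_potential_def [abs_def] ..
qed

text \<open>The kinetic term dominates the integrated tangent terms, after which the bound holds for
  almost every t separately. If the total is attained, the finite value of the bound forces equality
  for almost every t, and then for almost every s.\<close>

lemma lower_bound: "ennreal (mass * (1 + \<sigma> / 2)) \<le> 2 * action v \<sigma> y"
  and lower_bound_eq: "2 * action v \<sigma> y \<le> ennreal (mass * (1 + \<sigma> / 2)) \<Longrightarrow>
    AE t in unit_ivl. AE s in unit_ivl. norm (y (s + t) - y s) = 2 * sin (pi * t)"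
proof -
  let ?C = "\<lambda>t. ennreal (circle_kernel \<sigma> t * (1 + \<sigma> / 2))"
  have C: "integral\<^sup>N unit_ivl ?C = ennreal (mass * (1 + \<sigma> / 2))"
    using \<sigma> by (intro nn_integral_kernel_mult) auto
  have JQ: "(\<integral>\<^sup>+ t. pair_potential \<sigma> y t + ennreal (tangent_term \<sigma> y t) \<partial>unit_ivl) = integral\<^sup>N unit_ivl (pair_potential \<sigma> y) + (\<integral>\<^sup>+ t. ennreal (tangent_term \<sigma> y t) \<partial>unit_ivl)"
    by (intro nn_integral_add) auto
  also have "\<dots> \<le> 2 * action v \<sigma> y"
    unfolding two_action using nn_integral_tangent_term_le by (subst add.commute) (rule add_right_mono)
  finally have le: "(\<integral>\<^sup>+ t. pair_potential \<sigma> y t + ennreal (tangent_term \<sigma> y t) \<partial>unit_ivl) \<le> 2 * action v \<sigma> y" .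
  have pt: "AE t in unit_ivl. ?C t \<le> pair_potential \<sigma> y t + ennreal (tangent_term \<sigma> y t)"
    using AE_unit_ivl_interior by eventually_elim (rule pointwise_bound(1), auto)
  then have "integral\<^sup>N unit_ivl ?C \<le> (\<integral>\<^sup>+ t. pair_potential \<sigma> y t + ennreal (tangent_term \<sigma> y t) \<partial>unit_ivl)"
    by (rule nn_integral_mono_AE)
  then show "ennreal (mass * (1 + \<sigma> / 2)) \<le> 2 * action v \<sigma> y" using le C by simp
  assume eq: "2 * action v \<sigma> y \<le> ennreal (mass * (1 + \<sigma> / 2))"
  have "AE t in unit_ivl. pair_potential \<sigma> y t + ennreal (tangent_term \<sigma> y t) = ?C t"
    by (rule AE_eq_of_nn_integral_le[OF _ _ pt]) (use le eq C in auto)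
  then show "AE t in unit_ivl. AE s in unit_ivl. norm (y (s + t) - y s) = 2 * sin (pi * t)"
    using AE_unit_ivl_interior by eventually_elim (rule pointwise_bound(2), auto)
qed

lemma minimal_imp_circle:
  assumes "2 * action v \<sigma> y \<le> ennreal (mass * (1 + \<sigma> / 2))"
  shows "norm (y 0) = 1" "norm (y (1/4)) = 1" "y 0 \<bullet> y (1/4) = 0"
    "y t = cos (2 * pi * t) *\<^sub>R y 0 + sin (2 * pi * t) *\<^sub>R y (1/4)"
proof -
  note cont = LambdaD(3)[OF y] and per = LambdaD(1)[OF y]
  \<comment> \<open>Squares are compared because 2 - 2 cos(2 pi t) has period 1 in t, whereas sin(pi
    t) changes sign after one period. \<open>D\<close> is shown to vanish in all s for almost every
    t, and then in all t.\<close>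
  define D where "D s t = (norm (y (s + t) - y s))\<^sup>2 - (2 - 2 * cos (2 * pi * t))" for s t
  have per': "y (s + 1 + t) = y (s + t)" for s t using per[of "s + t"] by (simp add: add_ac)
  have D1: "D (s + 1) t = D s t" for s t by (simp add: D_def per per')
  have D2: "D s (t + 1) = D s t" for s t
    using per[of "s + t"] cos_periodic[of "2 * pi * t"] by (simp add: D_def algebra_simps)
  have c1: "continuous_on UNIV (\<lambda>s. D s t)" for t
    unfolding D_def by (intro continuous_intros cont continuous_comp_shift)
  have c2: "continuous_on UNIV (\<lambda>t. D s t)" for s
    unfolding D_def by (intro continuous_intros continuous_on_compose2[OF cont]) auto
  have "AE t in unit_ivl. \<forall>s. D s t = 0"
    using lower_bound_eq[OF assms]
  proof eventually_elim
    case (elim t)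
    have "(2 * sin (pi * t))\<^sup>2 = 2 - 2 * cos (2 * pi * t)"
      using cos_double_sin[of "pi * t"] by (simp add: mult.assoc power_mult_distrib)
    then have "AE s in unit_ivl. D s t = 0"
      using elim by (auto simp: D_def elim!: eventually_mono)
    then show ?case using AE_unit_ivl_continuous[OF c1 D1] by blast
  qed
  then have "AE t in unit_ivl. D s t = 0" for s by (rule eventually_mono) blast
  then have "D s t = 0" for s t by (rule AE_unit_ivl_continuous[OF c2 D2])
  then have ch: "(norm (y (s + t) - y s))\<^sup>2 = 2 - 2 * cos (2 * pi * t)" for s t
    by (simp add: D_def)
  note cc = circle_of_chords[OF cont per LambdaD(4)[OF y] ch]
  show "norm (y 0) = 1" "norm (y (1/4)) = 1" "y 0 \<bullet> y (1/4) = 0"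
    "y t = cos (2 * pi * t) *\<^sub>R y 0 + sin (2 * pi * t) *\<^sub>R y (1/4)"
    by (fact cc)+
qed

end

text \<open>The energy 4 pi^2 contributes \<open>mass * (\<sigma> / 2)\<close> and the potential
  contributes \<open>mass\<close>, since the chord of step t has length 2 sin(pi t) for every
  s.\<close>

lemma circle_minimal:
  fixes E1 E2 :: "'a::euclidean_space"
  assumes E: "norm E1 = 1" "norm E2 = 1" "orthogonal E1 E2"
  defines "y \<equiv> \<lambda>t. cos (2 * pi * t) *\<^sub>R E1 + sin (2 * pi * t) *\<^sub>R E2"
  shows "y \<in> Lambda" "2 * action v \<sigma> y = ennreal (mass * (1 + \<sigma> / 2))"
proof -
  define y' where "y' t = (2 * pi) *\<^sub>R (cos (2 * pi * t) *\<^sub>R E2 - sin (2 * pi * t) *\<^sub>R E1)" for t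
  have nrm: "(norm (a *\<^sub>R E1 + b *\<^sub>R E2))\<^sup>2 = a\<^sup>2 + b\<^sup>2" for a b
    using E unfolding power2_norm_eq_inner orthogonal_def norm_eq_1
    by (simp add: inner_commute algebra_simps power2_eq_square)
  have per: "y (t + 1) = y t" for t
    using cos_periodic[of "2 * pi * t"] sin_periodic[of "2 * pi * t"] by (simp add: y_def algebra_simps)
  have cont: "continuous_on A y" for A unfolding y_def by (intro continuous_intros)
  have cont': "continuous_on A y'" for A unfolding y'_def by (intro continuous_intros)
  have c: "((\<lambda>t. cos (2 * pi * t)) has_vector_derivative - (2 * pi * sin (2 * pi * t))) (at t)" for t
    by (auto intro!: derivative_eq_intros simp flip: has_real_derivative_iff_has_vector_derivative)
  have s: "((\<lambda>t. sin (2 * pi * t)) has_vector_derivative 2 * pi * cos (2 * pi * t)) (at t)" for t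
    by (auto intro!: derivative_eq_intros simp flip: has_real_derivative_iff_has_vector_derivative)
  have der: "(y has_vector_derivative y' t) (at t)" for t
  proof -
    have "(y has_vector_derivative (- (2 * pi * sin (2 * pi * t))) *\<^sub>R E1 + (2 * pi * cos (2 * pi * t)) *\<^sub>R E2) (at t)"
      unfolding y_def
      by (intro has_vector_derivative_add bounded_linear.has_vector_derivative[OF bounded_linear_scaleR_left] c s)
    then show ?thesis by (simp add: y'_def scaleR_diff_right)
  qed
  have wd: "has_weak_deriv y y'" by (rule has_weak_deriv_of_derivative[OF der cont'])
  have L2: "y \<in> L2_01" "y' \<in> L2_01" by (rule continuous_imp_L2_01[OF cont] continuous_imp_L2_01[OF cont'])+
  have H1: "y \<in> H1_01" using L2 wd cont by (auto simp: H1_01_def)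
  have "integral {0..1} y = 0"
  proof (rule integral_unique)
    define Y where "Y t = (1 / (2 * pi)) *\<^sub>R (sin (2 * pi * t) *\<^sub>R E1 - cos (2 * pi * t) *\<^sub>R E2)" for t
    have Y: "(Y has_vector_derivative y t) (at t)" for t
    proof -
      have "(Y has_vector_derivative (1 / (2 * pi)) *\<^sub>R ((2 * pi * cos (2 * pi * t)) *\<^sub>R E1 - (- (2 * pi * sin (2 * pi * t))) *\<^sub>R E2)) (at t)"
        unfolding Y_def
        by (intro bounded_linear.has_vector_derivative[OF bounded_linear_scaleR_right] has_vector_derivative_diff
            bounded_linear.has_vector_derivative[OF bounded_linear_scaleR_left] c s)
      then show ?thesis by (simp add: y_def scaleR_add_right)
    qed
    have "(y has_integral (Y 1 - Y 0)) {0..1}"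
      by (rule fundamental_theorem_of_calculus[OF zero_le_one has_vector_derivative_at_within[OF Y]])
    then show "(y has_integral 0) {0..1}" by (simp add: Y_def)
  qed
  then show y: "y \<in> Lambda"
    using H1 per lebesgue_integral_eq_integral[OF continuous_imp_integrable_real[OF cont[of "{0..1}"]]]
    by (simp add: Lambda_def H1_periodic_def)
  have "energy y = 4 * pi\<^sup>2"
  proof -
    have n: "(norm (y' t))\<^sup>2 = 4 * pi\<^sup>2" for t
    proof -
      have "(norm (cos (2 * pi * t) *\<^sub>R E2 - sin (2 * pi * t) *\<^sub>R E1))\<^sup>2 = 1"
        using nrm[of "- sin (2 * pi * t)" "cos (2 * pi * t)"] by simp
      then show ?thesis unfolding y'_def norm_scaleR power_mult_distrib by simp
    qed
    \<comment> \<open>\<open>weak_deriv y\<close> need not be \<open>y'\<close> itself, but agrees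
      with it almost everywhere.\<close>
    have ae: "AE t in lebesgue_on {0..1}. weak_deriv y t = y' t"
      using weak_deriv_AE_eq[OF cont weak_deriv_spec[OF H1] L2(2) wd] .
    have m: "(\<lambda>t. (norm (weak_deriv y t))\<^sup>2) \<in> borel_measurable (lebesgue_on {0..1})"
      "integrable (lebesgue_on {0..1}) (\<lambda>t. (norm (weak_deriv y t))\<^sup>2)"
      using weak_deriv_spec(1)[OF H1] by (auto simp: L2_01_def)
    have "energy y = (LINT t|lebesgue_on {0..1}. (norm (weak_deriv y t))\<^sup>2)"
      unfolding energy_def using m(2) by (simp add: lebesgue_integral_eq_integral)
    also have "\<dots> = (LINT t|lebesgue_on {0..1::real}. 4 * pi\<^sup>2)"
      by (rule integral_cong_AE) (use ae m in \<open>auto simp: n elim!: eventually_mono\<close>)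
    also have "\<dots> = 4 * pi\<^sup>2"
      using lebesgue_integral_eq_integral[OF continuous_imp_integrable_real[of 0 1 "\<lambda>_. 4 * pi\<^sup>2"]] by simp
    finally show ?thesis .
  qed
  then have e: "v\<^sup>2 * energy y = mass * (\<sigma> / 2)"
    by (simp add: v mass_def field_simps)
  have J: "integral\<^sup>N unit_ivl (pair_potential \<sigma> y) = ennreal (mass * 1)"
  proof -
    have "AE t in unit_ivl. pair_potential \<sigma> y t = ennreal (circle_kernel \<sigma> t * 1)"
      using AE_unit_ivl_interior
    proof eventually_elim
      case (elim t)
      then have s0: "0 < 2 * sin (pi * t)" by (auto intro!: sin_gt_zero)
      have "norm (y s - y (s + t)) = 2 * sin (pi * t)" for s
      proof -
        have "y s - y (s + t) = (cos (2 * pi * s) - cos (2 * pi * (s + t))) *\<^sub>R E1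
            + (sin (2 * pi * s) - sin (2 * pi * (s + t))) *\<^sub>R E2"
          by (simp add: y_def algebra_simps)
        then have "(norm (y s - y (s + t)))\<^sup>2 = (cos (2 * pi * s) - cos (2 * pi * (s + t)))\<^sup>2
            + (sin (2 * pi * s) - sin (2 * pi * (s + t)))\<^sup>2" by (simp add: nrm)
        also have "\<dots> = ((sin (2 * pi * s))\<^sup>2 + (cos (2 * pi * s))\<^sup>2)
           + ((sin (2 * pi * (s + t)))\<^sup>2 + (cos (2 * pi * (s + t)))\<^sup>2)
           - 2 * cos (2 * pi * (s + t) - 2 * pi * s)"
          unfolding cos_diff by (simp add: power2_eq_square algebra_simps)
        also have "\<dots> = 2 - 2 * cos (2 * (pi * t))"
          by (simp only: sin_cos_squared_add) (simp add: algebra_simps)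
        also have "\<dots> = (2 * sin (pi * t))\<^sup>2"
          unfolding cos_double_sin by (simp add: power_mult_distrib)
        finally show ?thesis by (rule power2_eq_imp_eq) (use s0 in auto)
      qed
      moreover have "1 / ennreal ((2 * sin (pi * t)) powr \<sigma>) = ennreal (circle_kernel \<sigma> t)"
        using divide_ennreal[of 1 "(2 * sin (pi * t)) powr \<sigma>"] s0 by (simp add: circle_kernel_def)
      ultimately show ?case
        using emeasure_unit_ivl by (simp add: pair_potential_def)
    qed
    then have "integral\<^sup>N unit_ivl (pair_potential \<sigma> y) = (\<integral>\<^sup>+ t. ennreal (circle_kernel \<sigma> t * 1) \<partial>unit_ivl)"
      by (rule nn_integral_cong_AE)
    also have "\<dots> = ennreal (mass * 1)" by (rule nn_integral_kernel_mult) simp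
    finally show ?thesis .
  qed
  show "2 * action v \<sigma> y = ennreal (mass * (1 + \<sigma> / 2))"
    unfolding two_action[OF y] e J using mass_nonneg \<sigma>
    by (simp add: algebra_simps flip: ennreal_plus)
qed

end

lemma unit_circle_iff:
  "unit_circle y \<longleftrightarrow> (\<exists>E1 E2. norm E1 = 1 \<and> norm E2 = 1 \<and> orthogonal E1 E2 \<and>
     y = (\<lambda>t. cos (2 * pi * t) *\<^sub>R E1 + sin (2 * pi * t) *\<^sub>R E2))" (is "_ \<longleftrightarrow> ?R")
proof
  show "?R" if "unit_circle y" using that unfolding unit_circle_def by blast
  assume ?R
  then obtain E1 E2 where E: "norm E1 = 1" "norm E2 = 1" "orthogonal E1 E2"
    and y: "y = (\<lambda>t. cos (2 * pi * t) *\<^sub>R E1 + sin (2 * pi * t) *\<^sub>R E2)" by blast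
  \<comment> \<open>The coefficient (E1 - i E2) / 2, forced by
    \<open>E1 = 2 *\<^sub>R Re_vec a\<close> and \<open>E2 = - 2 *\<^sub>R Im_vec a\<close>.\<close>
  define a where "a = (\<chi> k. Complex (E1 $ k / 2) (- (E2 $ k / 2)))"
  have "E1 = 2 *\<^sub>R Re_vec a" "E2 = - 2 *\<^sub>R Im_vec a"
    by (simp_all add: a_def Re_vec_def Im_vec_def vec_eq_iff)
  moreover have "of_real_vec (y t) = exp (2 * pi * \<i> * t) *s a + exp (- (2 * pi * \<i> * t)) *s cnj_vec a" for t
  proof -
    have e: "exp (2 * pi * \<i> * t) = cis (2 * pi * t)" "exp (- (2 * pi * \<i> * t)) = cis (- (2 * pi * t))"
      by (simp_all add: cis_conv_exp mult_ac)
    show ?thesis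
      unfolding e by (simp add: vec_eq_iff of_real_vec_def cnj_vec_def a_def y complex_eq_iff)
  qed
  ultimately show "unit_circle y" unfolding unit_circle_def using E y by blast
qed

theorem theorem3p5:
  fixes \<sigma> v :: real
  assumes "CARD('d::finite) \<ge> 2"
    and "0 < \<sigma>" and "\<sigma> < 1"
    and "v\<^sup>2 = \<sigma> / (8 * pi\<^sup>2) * (LINT t|lebesgue_on {0..1}. 1 / (2 * sin (pi * t)) powr \<sigma>)"
  shows "(\<exists>y :: real \<Rightarrow> real ^ 'd. is_arg_min (action v \<sigma>) (\<lambda>y. y \<in> Lambda) y) \<and>
         (\<forall>y :: real \<Rightarrow> real ^ 'd.
            is_arg_min (action v \<sigma>) (\<lambda>y. y \<in> Lambda) y \<longleftrightarrow> unit_circle y)"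
proof -
  interpret circle_problem \<sigma> v
    using assms by unfold_locales (simp_all add: circle_kernel_def)
  define m where "m = ennreal (mass * (1 + \<sigma> / 2))"
  have two: "2 * a < 2 * b" if "a < b" for a b :: ennreal
    using that by (intro ennreal_mult_strict_left_mono) auto
  have circ: "y \<in> Lambda" "2 * action v \<sigma> y = m" if "unit_circle y" for y :: "real \<Rightarrow> real ^ 'd"
    using that circle_minimal unfolding unit_circle_iff m_def by blast+
  have min: "is_arg_min (action v \<sigma>) (\<lambda>y. y \<in> Lambda) y" if "unit_circle y" for y :: "real \<Rightarrow> real ^ 'd"
  proof -
    note y = circ[OF that]
    have "\<not> action v \<sigma> z < action v \<sigma> y" if "z \<in> Lambda" for z :: "real \<Rightarrow> real ^ 'd"
      using lower_bound[OF that] two[of "action v \<sigma> z" "action v \<sigma> y"] y(2) by (auto simp: m_def)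
    then show ?thesis using y(1) by (auto simp: is_arg_min_def)
  qed
  \<comment> \<open>As d >= 2, two distinct coordinate axes span a unit circle. It shows that the
    minimum is attained and supplies the value against which any other minimiser is
    compared.\<close>
  obtain i j :: 'd where "i \<noteq> j" using assms(1)
    by (metis (full_types) card_2_iff' ex_card)
  then have ex: "unit_circle (\<lambda>t. cos (2 * pi * t) *\<^sub>R axis i 1 + sin (2 * pi * t) *\<^sub>R (axis j 1 :: real ^ 'd))" (is "unit_circle ?y")
    unfolding unit_circle_iff by (intro exI[of _ "axis i 1"] exI[of _ "axis j 1"]) (auto simp: orthogonal_def inner_axis_axis norm_axis_1)
  have "unit_circle y" if y: "is_arg_min (action v \<sigma>) (\<lambda>y. y \<in> Lambda) y" for y :: "real \<Rightarrow> real ^ 'd"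
  proof -
    have yL: "y \<in> Lambda" and "\<not> action v \<sigma> ?y < action v \<sigma> y"
      using y min[OF ex] by (auto simp: is_arg_min_def)
    then have "2 * action v \<sigma> y \<le> 2 * action v \<sigma> ?y" by (intro mult_left_mono) auto
    also have "\<dots> = m" by (rule circ(2)[OF ex])
    finally have "2 * action v \<sigma> y \<le> ennreal (mass * (1 + \<sigma> / 2))" by (simp add: m_def)
    note c = minimal_imp_circle[OF yL this]
    show ?thesis
      unfolding unit_circle_iff
    proof (intro exI conjI)
      show "orthogonal (y 0) (y (1/4))" using c(3) by (simp add: orthogonal_def)
      show "y = (\<lambda>t. cos (2 * pi * t) *\<^sub>R y 0 + sin (2 * pi * t) *\<^sub>R y (1/4))" by (rule ext) (rule c(4))
    qed (rule c(1,2))+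
  qed
  then show ?thesis using min ex by blast
qed

end
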